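(* Let $d\ge 1$, $\Omega=[0,1]^d$, and let $u\in\mathcal B(\Omega)$ with spectral Barron norm $\|u\|_{\mathcal B(\Omega)}$. Then for every integer $m\ge 1$ there exist $c\in\mathbb R$, $\gamma_1,\dots,\gamma_m\in\mathbb R$, $w_1,\dots,w_m\in\mathbb R^d$ and $t_1,\dots,t_m\in\mathbb R$ with $$|c|\le 2\|u\|_{\mathcal B(\Omega)},\qquad |w_i|_1=1,\qquad |t_i|\le 1\ (1\le i\le m),\qquad \sum_{i=1}^m|\gamma_i|\le 4\|u\|_{\mathcal B(\Omega)},$$ such that the two-layer ReLU network $u_m(x)=c+\sum_{i=1}^m\gamma_i\,\mathrm{ReLU}(w_i\cdot x-t_i)$ satisfies $$\|u-u_m\|_{H^1(\Omega)}\le\frac{\sqrt{116}\,\|u\|_{\mathcal B(\Omega)}}{\sqrt m}.$$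
   Context: $|\cdot|_1$ is the $\ell^1$-norm on $\mathbb R^d$; $\mathrm{ReLU}(z)=\max(z,0)$; $\mathbb N_0=\{0,1,2,\dots\}$; $\|v\|_{H^1(\Omega)}^2=\|v\|_{L^2(\Omega)}^2+\|\nabla v\|_{L^2(\Omega)}^2$. For $k\in\mathbb N_0^d$ put $\Phi_k(x)=\prod_{i=1}^d\cos(\pi k_ix_i)$, and for $u\in L^1(\Omega)$ let $\hat u(k)=\int_\Omega u\,\Phi_k\,dx\big/\int_\Omega\Phi_k^2\,dx$ be its cosine expansion coefficients. The spectral Barron space is $\mathcal B(\Omega)=\{u\in L^1(\Omega):\|u\|_{\mathcal B(\Omega)}<\infty\}$, where $\|u\|_{\mathcal B(\Omega)}=\sum_{k\in\mathbb N_0^d}(1+\pi^2|k|_1^2)|\hat u(k)|$. *)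

theory Defs
  imports "HOL-Analysis.Analysis"
begin

text \<open>
  The dimension \<open>d \<ge> 1\<close> is \<open>CARD('n)\<close>; here \<open>0\<close> and \<open>1\<close> are the constant vectors, so
  \<open>unit_cube\<close> is \<open>[0,1]^d\<close>.  All integrals are Lebesgue integrals over it.
\<close>

definition unit_cube :: "(real ^ 'n) set" where
  "unit_cube = cbox 0 1"

definition l1_norm :: "real ^ 'n \<Rightarrow> real" where
  "l1_norm x = (\<Sum>i\<in>UNIV. \<bar>x $ i\<bar>)"

definition ReLU :: "real \<Rightarrow> real" where
  "ReLU z = max z 0"


subsection \<open>The spectral Barron space\<close>

definition cos_mode :: "nat ^ 'n \<Rightarrow> real ^ 'n \<Rightarrow> real" where
  "cos_mode k x = (\<Prod>i\<in>UNIV. cos (pi * real (k $ i) * x $ i))"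

definition cos_coeff :: "(real ^ 'n \<Rightarrow> real) \<Rightarrow> nat ^ 'n \<Rightarrow> real" where
  "cos_coeff u k =
     (LINT x|lebesgue_on unit_cube. u x * cos_mode k x) /
     (LINT x|lebesgue_on unit_cube. (cos_mode k x)\<^sup>2)"

text \<open>The norm is a sum in \<open>[0,\<infinity>]\<close>, so that finiteness is a genuine condition.\<close>

definition barron_enorm :: "(real ^ 'n \<Rightarrow> real) \<Rightarrow> ennreal" where
  "barron_enorm u =
     (\<Sum>\<^sub>\<infinity>k\<in>UNIV. ennreal ((1 + pi\<^sup>2 * (l1_norm (\<chi> i. real (k $ i)))\<^sup>2) * \<bar>cos_coeff u k\<bar>))"

definition barron_space :: "(real ^ 'n \<Rightarrow> real) set" where
  "barron_space = {u. integrable (lebesgue_on unit_cube) u \<and> barron_enorm u < \<infinity>}"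

definition barron_norm :: "(real ^ 'n \<Rightarrow> real) \<Rightarrow> real" where
  "barron_norm u = enn2real (barron_enorm u)"


subsection \<open>The Sobolev space \<open>H\<^sup>1\<close> of the unit cube\<close>

definition partial_deriv :: "'n \<Rightarrow> (real ^ 'n \<Rightarrow> real) \<Rightarrow> real ^ 'n \<Rightarrow> real" where
  "partial_deriv i f x = frechet_derivative f (at x) (axis i 1)"

primrec Ck :: "nat \<Rightarrow> (real ^ 'n \<Rightarrow> real) \<Rightarrow> bool" where
  "Ck 0 f \<longleftrightarrow> continuous_on UNIV f"
| "Ck (Suc k) f \<longleftrightarrow> (\<forall>x. f differentiable at x) \<and> (\<forall>i. Ck k (partial_deriv i f))"

text \<open>\<open>C\<^sup>\<infinity>\<close> functions with compact support in the open cube, extended by zero.\<close>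

definition test_function :: "(real ^ 'n \<Rightarrow> real) \<Rightarrow> bool" where
  "test_function \<phi> \<longleftrightarrow> (\<forall>k. Ck k \<phi>) \<and>
     compact (closure {x. \<phi> x \<noteq> 0}) \<and> closure {x. \<phi> x \<noteq> 0} \<subseteq> interior unit_cube"

definition locally_integrable :: "(real ^ 'n \<Rightarrow> 'b::euclidean_space) \<Rightarrow> bool" where
  "locally_integrable f \<longleftrightarrow>
     (\<forall>K. compact K \<and> K \<subseteq> interior unit_cube \<longrightarrow> f absolutely_integrable_on K)"

definition has_weak_gradient ::
    "(real ^ 'n \<Rightarrow> real) \<Rightarrow> (real ^ 'n \<Rightarrow> real ^ 'n) \<Rightarrow> bool" where
  "has_weak_gradient v G \<longleftrightarrow> locally_integrable v \<and> locally_integrable G \<and>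
     (\<forall>\<phi> i. test_function \<phi> \<longrightarrow>
        (LINT x|lebesgue_on unit_cube. v x * partial_deriv i \<phi> x) =
        - (LINT x|lebesgue_on unit_cube. G x $ i * \<phi> x))"

text \<open>Well defined up to null sets: weak gradients agree almost everywhere on the cube.\<close>

definition weak_gradient :: "(real ^ 'n \<Rightarrow> real) \<Rightarrow> real ^ 'n \<Rightarrow> real ^ 'n" where
  "weak_gradient v = (SOME G. has_weak_gradient v G)"

definition L2_space :: "(real ^ 'n \<Rightarrow> 'b::euclidean_space) set" where
  "L2_space = {f. f \<in> borel_measurable (lebesgue_on unit_cube) \<and>
     integrable (lebesgue_on unit_cube) (\<lambda>x. (norm (f x))\<^sup>2)}"

definition L2_norm :: "(real ^ 'n \<Rightarrow> 'b::euclidean_space) \<Rightarrow> real" where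
  "L2_norm f = sqrt (LINT x|lebesgue_on unit_cube. (norm (f x))\<^sup>2)"

definition H1_space :: "(real ^ 'n \<Rightarrow> real) set" where
  "H1_space = {v. v \<in> L2_space \<and> (\<exists>G. has_weak_gradient v G \<and> G \<in> L2_space)}"

definition H1_norm :: "(real ^ 'n \<Rightarrow> real) \<Rightarrow> real" where
  "H1_norm v = sqrt ((L2_norm v)\<^sup>2 + (L2_norm (weak_gradient v))\<^sup>2)"


definition two_layer_net ::
    "nat \<Rightarrow> real \<Rightarrow> (nat \<Rightarrow> real) \<Rightarrow> (nat \<Rightarrow> real ^ 'n) \<Rightarrow> (nat \<Rightarrow> real) \<Rightarrow> real ^ 'n \<Rightarrow> real" where
  "two_layer_net m c \<gamma> w t x = c + (\<Sum>i=1..m. \<gamma> i * ReLU (w i \<bullet> x - t i))"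

end

theory Submission
  imports Defs
begin

text \<open>
  The network is found by Maurey's argument: a target that is an average of neurons is approximated
  at rate \<open>1 / \<surd>m\<close> by \<open>m\<close> of them.  Why is \<open>u\<close> an average of ReLU neurons?  A product of cosines is the
  mean over all sign patterns of the ridge functions \<open>cos (l \<bullet> x)\<close>, where \<open>l\<close> has the entries
  \<open>\<plusminus> pi k\<^sub>i\<close>, so that \<open>|l|\<^sub>1 = pi |k|\<^sub>1\<close>.  Write \<open>l = \<rho> w\<close> with \<open>|w|\<^sub>1 = 1\<close>; then \<open>z = w \<bullet> x\<close> stays in
  \<open>[-1, 1]\<close> on the cube, and because \<open>cos (\<rho> z)\<close> is flat at \<open>z = 0\<close>, Taylor's formula with integral
  remainder leaves only a constant and neurons:

    \<open>cos (\<rho> z) - 1 = - \<rho>\<^sup>2 \<integral>\<^sub>0\<^sup>1 cos (\<rho> t) (ReLU (z - t) + ReLU (- z - t)) dt\<close>.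

  The neurons carry total mass at most \<open>2 \<rho>\<^sup>2\<close>.  Summed against the coefficients of \<open>u\<close>, this gives the
  constant \<open>c\<close>, the sum of all coefficients, with \<open>\<bar>c\<bar> \<le> B\<close>, and a mixture of neurons with mass at most \<open>2 B\<close>, where
  \<open>B\<close> is the Barron norm.

  A function and its gradient are carried together as one map into \<open>\<real> \<times> \<real>\<^sup>n\<close>, here called an atom.
  Then the \<open>H\<^sup>1\<close> inner product is just the \<open>L\<^sup>2\<close> inner product of atoms, and no separate
  argument is needed for derivatives.  The integral representation is used only in dual form
  (\<open>barron_series_pairing\<close>): if a bounded field \<open>R\<close> pairs with every neuron atom to at most \<open>s\<close>, it
  pairs with the atom \<open>F\<close> of \<open>u - c\<close> to at most \<open>2 B s\<close>.  This one estimate is used twice.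

  It drives the choice of neurons.  Maurey's random sampling is replaced by a deterministic greedy
  choice (\<open>greedy_approximation\<close>): neuron \<open>m + 1\<close> only has to pair with the current residual at least
  as well as \<open>F\<close> does, which keeps the squared norm of the unnormalised residual at most \<open>m K\<close>.
  The supremum over neurons need not be attained; taking neurons of weight \<open>\<plusminus> 4 B\<close>, twice the mass
  of the mixture, leaves room for this.  With thresholds in \<open>[0, 1]\<close> one has \<open>K \<le> (5/2 + 8)\<^sup>2 B\<^sup>2 \<le> 116 B\<^sup>2\<close>.

  It also identifies the weak gradient of \<open>u\<close>.  For a test function \<open>\<phi>\<close> put \<open>R = (\<partial>\<^sub>i \<phi>, \<phi> e\<^sub>i)\<close>.  The
  second component of an atom is a weak gradient of the first exactly if all these \<open>R\<close> are orthogonal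
  to the atom.
  Neurons are Lipschitz, so this holds for them with \<open>s = 0\<close>, hence it holds for \<open>F\<close>.

  Two facts of analysis are needed besides.  An integrable function that is orthogonal to all test
  functions vanishes almost everywhere (\<open>test_function_orthogonal_imp_zero\<close>); this makes the weak
  gradient unique, so that the \<open>H\<^sup>1\<close> norm can be computed from any weak gradient.  Together
  with the Stone--Weierstrass theorem it also shows that the cosine modes are complete, so that \<open>u\<close> is
  almost everywhere the sum of its cosine series.
\<close>

section \<open>Smooth bumps supported in boxes\<close>

text \<open>
  The functions \<open>p (1/t) exp (- 1/t)\<close> for \<open>t > 0\<close>, extended by zero: a family that contains the
  standard \<open>exp (- 1/t)\<close> and is closed under differentiation, so that smoothness needs no formula for
  the higher derivatives.
\<close>

definition flat :: "real poly \<Rightarrow> real \<Rightarrow> real" where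
  "flat p t = (if t > 0 then poly p (1 / t) * exp (- (1 / t)) else 0)"

lemma poly_exp_decay: "((\<lambda>y. poly p y * exp (- y)) \<longlongrightarrow> (0::real)) at_top"
proof -
  have "((\<lambda>y. \<Sum>i\<le>degree p. coeff p i * (y ^ i / exp y)) \<longlongrightarrow> (0::real)) at_top"
    by (intro tendsto_null_sum tendsto_mult_right_zero tendsto_power_div_exp_0)
  then show ?thesis
    by (simp add: poly_altdef sum_distrib_right sum_divide_distrib exp_minus field_simps)
qed

lemma flat_has_derivative:
  "(flat p has_real_derivative flat ([:0, 0, 1:] * (p - pderiv p)) t) (at t)"
proof (cases "t = 0")
  case False
  show ?thesis
  proof (cases "t > 0")
    case True
    have "((\<lambda>t. poly p (1 / t) * exp (- (1 / t))) has_real_derivative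
        flat ([:0, 0, 1:] * (p - pderiv p)) t) (at t)"
      using True
      by (auto intro!: derivative_eq_intros simp: flat_def field_simps power2_eq_square)
    then show ?thesis
      by (rule DERIV_cong_ev[THEN iffD1, rotated -1])
         (use True in \<open>auto simp: flat_def intro!: eventually_mono[OF eventually_nhds_in_open[of "{0<..}"]]\<close>)
  next
    case F: False
    have "((\<lambda>t. 0) has_real_derivative flat ([:0, 0, 1:] * (p - pderiv p)) t) (at t)"
      using F False by (auto simp: flat_def)
    then show ?thesis
      by (rule DERIV_cong_ev[THEN iffD1, rotated -1])
         (use F False in \<open>auto simp: flat_def intro!: eventually_mono[OF eventually_nhds_in_open[of "{..<0}"]]\<close>)
  qed
next
  case True
  have "((\<lambda>h. poly ([:0, 1:] * p) (inverse h) * exp (- inverse h)) \<longlongrightarrow> 0) (at_right 0)"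
    by (rule filterlim_compose[OF poly_exp_decay filterlim_inverse_at_top_right])
  then have R: "((\<lambda>h. flat p h / h) \<longlongrightarrow> 0) (at_right 0)"
    by (rule Lim_transform_eventually)
       (auto simp: eventually_at_filter flat_def field_simps)
  have L: "((\<lambda>h. flat p h / h) \<longlongrightarrow> 0) (at_left 0)"
    by (rule tendsto_eventually) (auto simp: eventually_at_filter flat_def)
  show ?thesis
    using True L R by (simp add: DERIV_def flat_def filterlim_at_split)
qed

text \<open>
  Membership in this algebra is the induction invariant for \<open>Ck\<close>: every element is
  differentiable, and its partial derivatives stay inside.
\<close>

inductive_set flat_algebra :: "(real ^ 'n \<Rightarrow> real) set" where
  flat: "(\<lambda>x. flat p (c * x $ i + e)) \<in> flat_algebra"
| const: "(\<lambda>x. c) \<in> flat_algebra"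
| add: "f \<in> flat_algebra \<Longrightarrow> g \<in> flat_algebra \<Longrightarrow> (\<lambda>x. f x + g x) \<in> flat_algebra"
| mult: "f \<in> flat_algebra \<Longrightarrow> g \<in> flat_algebra \<Longrightarrow> (\<lambda>x. f x * g x) \<in> flat_algebra"

lemma flat_algebra_prod:
  "finite A \<Longrightarrow> (\<And>i. i \<in> A \<Longrightarrow> f i \<in> flat_algebra) \<Longrightarrow> (\<lambda>x. \<Prod>i\<in>A. f i x) \<in> flat_algebra"
  by (induction A rule: finite_induct) (auto intro: flat_algebra.intros)

lemma flat_algebra_gradient:
  assumes "f \<in> flat_algebra"
  shows "\<exists>g. (\<forall>j. g j \<in> flat_algebra) \<and>
    (\<forall>x. (f has_derivative (\<lambda>h. \<Sum>j\<in>UNIV. g j x * h $ j)) (at x))"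
  using assms
proof induction
  case (flat p c i e)
  let ?q = "[:0, 0, 1:] * (p - pderiv p)"
  define g where "g = (\<lambda>j x. if j = i then c * flat ?q (c * x $ i + e) else 0)"
  have "g j \<in> flat_algebra" for j
    by (cases "j = i") (auto simp: g_def intro: flat_algebra.intros)
  moreover have "((\<lambda>x. flat p (c * x $ i + e)) has_derivative
      (\<lambda>h. \<Sum>j\<in>UNIV. g j x * h $ j)) (at x)" for x
  proof -
    have 1: "((\<lambda>x::real^'a. c * x $ i + e) has_derivative (\<lambda>h. c * h $ i)) (at x)"
      by (auto intro!: derivative_eq_intros bounded_linear_imp_has_derivative bounded_linear_vec_nth)
    have 2: "(flat p has_derivative (*) (flat ?q (c * x $ i + e))) (at (c * x $ i + e))"
      using flat_has_derivative[of p "c * x $ i + e"] by (simp add: has_field_derivative_def)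
    have "((\<lambda>x. flat p (c * x $ i + e)) has_derivative (\<lambda>h. flat ?q (c * x $ i + e) * (c * h $ i))) (at x)"
      using diff_chain_at[OF 1 2] by (simp add: o_def)
    moreover have "(\<Sum>j\<in>UNIV. g j x * h $ j) = flat ?q (c * x $ i + e) * (c * h $ i)" for h
      unfolding g_def by (subst sum.remove[of _ i]) auto
    ultimately show ?thesis by simp
  qed
  ultimately show ?case by blast
next
  case (const c)
  show ?case
    by (intro exI[of _ "\<lambda>_ _. 0"]) (auto intro: flat_algebra.intros)
next
  case (add f f')
  then obtain g g' where g: "\<And>j. g j \<in> flat_algebra" "\<And>j. g' j \<in> flat_algebra"
     "\<And>x. (f has_derivative (\<lambda>h. \<Sum>j\<in>UNIV. g j x * h $ j)) (at x)"
     "\<And>x. (f' has_derivative (\<lambda>h. \<Sum>j\<in>UNIV. g' j x * h $ j)) (at x)"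
    by blast
  show ?case
  proof (intro exI[of _ "\<lambda>j x. g j x + g' j x"] conjI allI)
    show "((\<lambda>x. f x + f' x) has_derivative (\<lambda>h. \<Sum>j\<in>UNIV. (g j x + g' j x) * h $ j)) (at x)" for x
      using has_derivative_add[OF g(3)[of x] g(4)[of x]] by (simp add: sum.distrib algebra_simps)
  qed (auto intro: flat_algebra.intros g)
next
  case (mult f f')
  then obtain g g' where g: "\<And>j. g j \<in> flat_algebra" "\<And>j. g' j \<in> flat_algebra"
     "\<And>x. (f has_derivative (\<lambda>h. \<Sum>j\<in>UNIV. g j x * h $ j)) (at x)"
     "\<And>x. (f' has_derivative (\<lambda>h. \<Sum>j\<in>UNIV. g' j x * h $ j)) (at x)"
    by blast
  show ?case
  proof (intro exI[of _ "\<lambda>j x. f x * g' j x + g j x * f' x"] conjI allI)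
    show "(\<lambda>x. f x * g' j x + g j x * f' x) \<in> flat_algebra" for j
      by (intro flat_algebra.add flat_algebra.mult g mult.hyps)
    show "((\<lambda>x. f x * f' x) has_derivative
        (\<lambda>h. \<Sum>j\<in>UNIV. (f x * g' j x + g j x * f' x) * h $ j)) (at x)" for x
      using has_derivative_mult[OF g(3)[of x] g(4)[of x]]
      by (simp add: sum.distrib sum_distrib_left sum_distrib_right algebra_simps)
  qed
qed

lemma partial_deriv_eq:
  assumes "(f has_derivative (\<lambda>h. \<Sum>j\<in>UNIV. g j * h $ j)) (at x)"
  shows "partial_deriv i f x = g i"
proof -
  have "partial_deriv i f x = (\<Sum>j\<in>UNIV. g j * axis i 1 $ j)"
    using frechet_derivative_at[OF assms] unfolding partial_deriv_def by metis
  also have "\<dots> = g i"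
    by (simp add: axis_def if_distrib cong: if_cong)
  finally show ?thesis .
qed

lemma flat_algebra_Ck: "f \<in> flat_algebra \<Longrightarrow> Ck k f"
proof (induction k arbitrary: f)
  case 0
  then have "f differentiable at x" for x
    using flat_algebra_gradient[OF 0] unfolding differentiable_def by blast
  then show ?case
    by (simp add: continuous_at_imp_continuous_on differentiable_imp_continuous_within)
next
  case (Suc k)
  obtain g where g: "\<And>j. g j \<in> flat_algebra"
    "\<And>x. (f has_derivative (\<lambda>h. \<Sum>j\<in>UNIV. g j x * h $ j)) (at x)"
    using flat_algebra_gradient[OF Suc.prems] by blast
  have "partial_deriv i f = g i" for i
    using partial_deriv_eq[OF g(2)] by blast
  with g Suc.IH show ?case by (auto simp: differentiable_def)
qed

text \<open>
  Dilating \<open>exp (- 1/t)\<close> to \<open>exp (- 1/(n t))\<close> raises it to the power \<open>1/n\<close>.  The support stays the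
  box, while the values inside tend to \<open>1\<close>; hence no partition of unity or mollification is needed to
  approximate the indicator of a box.
\<close>

definition box_bump :: "nat \<Rightarrow> real ^ 'n \<Rightarrow> real ^ 'n \<Rightarrow> real ^ 'n \<Rightarrow> real" where
  "box_bump n a b x =
     (\<Prod>i\<in>UNIV. flat 1 (real (Suc n) * (x $ i - a $ i)) * flat 1 (real (Suc n) * (b $ i - x $ i)))"

lemma interior_unit_cube: "interior unit_cube = (box 0 1 :: (real ^ 'n) set)"
  by (simp add: unit_cube_def interior_cbox)

lemma box_bump_nonzero: "box_bump n a b x \<noteq> 0 \<longleftrightarrow> x \<in> box a b"
proof -
  have "flat 1 t \<noteq> 0 \<longleftrightarrow> t > 0" for t by (simp add: flat_def)
  then show ?thesis
    by (auto simp: box_bump_def mem_box_cart zero_less_mult_iff)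
qed

lemma box_bump_range: "0 \<le> box_bump n a b x" "box_bump n a b x \<le> 1"
proof -
  have "0 \<le> flat 1 t" "flat 1 t \<le> 1" for t by (auto simp: flat_def)
  then show "0 \<le> box_bump n a b x" "box_bump n a b x \<le> 1"
    unfolding box_bump_def by (auto intro!: prod_nonneg prod_le_1 mult_le_one)
qed

lemma box_bump_test_function:
  assumes "cbox a b \<subseteq> box 0 1"
  shows "test_function (box_bump n a b)"
proof -
  have "box_bump n a b = (\<lambda>x. \<Prod>i\<in>UNIV. flat 1 (real (Suc n) * x $ i + - real (Suc n) * a $ i)
      * flat 1 (- real (Suc n) * x $ i + real (Suc n) * b $ i))"
    by (intro ext) (simp add: box_bump_def algebra_simps)
  also have "\<dots> \<in> flat_algebra"
    by (intro flat_algebra_prod flat_algebra.mult flat_algebra.flat) auto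
  finally have Ck: "Ck k (box_bump n a b)" for k
    by (rule flat_algebra_Ck)
  have "{x. box_bump n a b x \<noteq> 0} = box a b"
    using box_bump_nonzero by blast
  moreover have "closure (box a b) \<subseteq> cbox a b"
    by (rule closure_minimal) (auto simp: box_subset_cbox)
  moreover have "compact (closure (box a b))"
    using bounded_box by (metis compact_closure)
  ultimately show ?thesis
    using assms Ck by (auto simp: test_function_def interior_unit_cube)
qed

lemma box_bump_tendsto: "(\<lambda>n. box_bump n a b x) \<longlonglongrightarrow> indicator (box a b) x"
proof (cases "x \<in> box a b")
  case False
  then have "box_bump n a b x = 0" for n using box_bump_nonzero by blast
  with False show ?thesis by simp
next
  case True
  have *: "(\<lambda>n. flat 1 (real (Suc n) * t)) \<longlonglongrightarrow> 1" if "t > 0" for t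
  proof -
    have "(\<lambda>n. 1 / t * (1 / real (Suc n))) \<longlonglongrightarrow> 1 / t * 0"
      by (intro tendsto_mult tendsto_const LIMSEQ_inverse_real_of_nat[unfolded inverse_eq_divide])
    then have "(\<lambda>n. exp (- (1 / t * (1 / real (Suc n))))) \<longlonglongrightarrow> exp (- (1/t*0))"
      by (intro tendsto_exp tendsto_minus)
    then show ?thesis using that by (simp add: flat_def mult.commute)
  qed
  have "(\<lambda>n. box_bump n a b x) \<longlonglongrightarrow> (\<Prod>i\<in>(UNIV::'a set). 1 * 1)"
    unfolding box_bump_def by (intro tendsto_prod tendsto_mult *) (use True in \<open>auto simp: mem_box_cart\<close>)
  with True show ?thesis by simp
qed


section \<open>The fundamental lemma of the calculus of variations\<close>

text \<open>
  The sets over which \<open>f\<close> integrates to zero form a Dynkin system, and boxes are an intersection-stable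
  generator of the Borel sets.
\<close>

lemma AE_zero_if_box_integrals_zero:
  fixes f :: "'a::euclidean_space \<Rightarrow> real"
  assumes int: "integrable lborel f"
    and total: "(LINT x|lborel. f x) = 0"
    and box: "\<And>a b. (LINT x:box a b|lborel. f x) = 0"
  shows "AE x in lborel. f x = 0"
proof -
  have "(LINT x:A|lborel. f x) = 0" if "A \<in> sets borel" for A
  proof -
    have A: "A \<in> sigma_sets UNIV (range (\<lambda>(a, b). box a b :: 'a set))"
      using that unfolding borel_eq_box by simp
    have stable: "Int_stable (range (\<lambda>(a, b). box a b :: 'a set))"
      by (auto simp: Int_stable_def box_Int_box)
    have "range (\<lambda>(a, b). box a b :: 'a set) \<subseteq> Pow UNIV"
      by simp
    from stable this A show ?thesis
    proof (induction rule: sigma_sets_induct_disjoint)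
      case (basic A)
      then show ?case using box by auto
    next
      case empty
      then show ?case by (simp add: set_lebesgue_integral_def)
    next
      case (compl A)
      have A: "A \<in> sets lborel"
        using compl.hyps unfolding sets_lborel borel_eq_box by simp
      have "(LINT x:UNIV - A|lborel. f x) = (LINT x|lborel. f x - indicator A x *\<^sub>R f x)"
        unfolding set_lebesgue_integral_def by (intro Bochner_Integration.integral_cong) (auto simp: indicator_def)
      also have "\<dots> = (LINT x|lborel. f x) - (LINT x:A|lborel. f x)"
        unfolding set_lebesgue_integral_def
        by (intro Bochner_Integration.integral_diff int integrable_mult_indicator A)
      finally show ?case using compl.IH total by simp
    next
      case (union A)
      have A: "A i \<in> sets lborel" for i
        using union.hyps unfolding sets_lborel borel_eq_box by auto
      have "set_integrable lborel (\<Union>i. A i) f"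
        unfolding set_integrable_def by (intro integrable_mult_indicator int sets.countable_UN) (use A in auto)
      then have "(LINT x:(\<Union>i. A i)|lborel. f x) = (\<Sum>i. LINT x:A i|lborel. f x)"
        using union.hyps(1)
        by (intro lebesgue_integral_countable_add A) (auto simp: disjoint_family_on_def)
      then show ?case using union.IH by simp
    qed
  qed
  then show ?thesis
    using density_unique_real[of lborel f "\<lambda>_. 0"] int by (simp add: set_lebesgue_integral_def)
qed

lemma LINT_unit_cube:
  fixes f :: "real ^ 'n \<Rightarrow> 'b::euclidean_space"
  assumes "\<And>x. x \<notin> unit_cube \<Longrightarrow> f x = 0"
  shows "(LINT x|lebesgue_on unit_cube. f x) = (LINT x|lebesgue. f x)"
proof -
  have "(LINT x|lebesgue_on unit_cube. f x) = (LINT x|lebesgue. indicator unit_cube x *\<^sub>R f x)"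
    by (intro integral_restrict_space) (auto simp: unit_cube_def)
  also have "(\<lambda>x. indicator unit_cube x *\<^sub>R f x) = f"
    using assms by (force simp: indicator_def)
  finally show ?thesis .
qed

text \<open>
  Box bumps converge boundedly to the indicator of a box, so all integrals of \<open>v\<close> over boxes inside the
  open cube vanish.  Since \<open>v\<close> is only locally integrable there, the previous lemma is applied on an
  exhausting sequence of compact boxes; the boundary of the cube is a null set.
\<close>

lemma test_function_orthogonal_imp_zero:
  fixes v :: "real ^ 'n \<Rightarrow> real"
  assumes loc: "locally_integrable v"
    and orth: "\<And>\<phi>. test_function \<phi> \<Longrightarrow> (LINT x|lebesgue_on unit_cube. v x * \<phi> x) = 0"
  shows "AE x in lebesgue_on unit_cube. v x = 0"
proof -
  have box0: "(LINT x:box a b|lebesgue. v x) = 0" if ab: "cbox a b \<subseteq> box 0 1" for a b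
  proof -
    have iv: "integrable lebesgue (\<lambda>x. indicator (cbox a b) x *\<^sub>R v x)"
      using loc ab unfolding locally_integrable_def interior_unit_cube set_integrable_def by auto
    have bump: "box_bump n a b \<in> borel_measurable borel" for n
      using box_bump_test_function[OF ab, of n]
      by (intro borel_measurable_continuous_onI) (metis test_function_def Ck.simps(1))
    have eq: "(LINT x|lebesgue_on unit_cube. v x * box_bump n a b x)
        = (LINT x|lebesgue. (indicator (cbox a b) x *\<^sub>R v x) * box_bump n a b x)" for n
    proof -
      have 0: "box_bump n a b x = 0" if "x \<notin> cbox a b" for x
        using box_bump_nonzero[of n a b x] that box_subset_cbox by blast
      have "cbox a b \<subseteq> unit_cube"
        using ab box_subset_cbox by (auto simp: unit_cube_def)
      then have "(LINT x|lebesgue_on unit_cube. v x * box_bump n a b x) = (LINT x|lebesgue. v x * box_bump n a b x)"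
        by (intro LINT_unit_cube) (use 0 in auto)
      also have "\<dots> = (LINT x|lebesgue. (indicator (cbox a b) x *\<^sub>R v x) * box_bump n a b x)"
        by (intro Bochner_Integration.integral_cong) (auto simp: indicator_def 0)
      finally show ?thesis .
    qed
    have "(\<lambda>n. LINT x|lebesgue. (indicator (cbox a b) x *\<^sub>R v x) * box_bump n a b x)
       \<longlonglongrightarrow> (LINT x|lebesgue. (indicator (cbox a b) x *\<^sub>R v x) * indicator (box a b) x)"
    proof (rule integral_dominated_convergence[where w = "\<lambda>x. \<bar>indicator (cbox a b) x *\<^sub>R v x\<bar>"])
      show "AE x in lebesgue. (\<lambda>n. (indicator (cbox a b) x *\<^sub>R v x) * box_bump n a b x)
         \<longlonglongrightarrow> (indicator (cbox a b) x *\<^sub>R v x) * indicator (box a b) x"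
        by (intro AE_I2 tendsto_mult_left box_bump_tendsto)
      show "AE x in lebesgue. norm ((indicator (cbox a b) x *\<^sub>R v x) * box_bump n a b x)
          \<le> \<bar>indicator (cbox a b) x *\<^sub>R v x\<bar>" for n
        by (intro AE_I2) (auto simp: abs_mult indicator_def intro!: mult_left_le box_bump_range
            abs_le_iff[THEN iffD2] order_trans[OF _ box_bump_range(1)])
      show "(\<lambda>x. (indicator (cbox a b) x *\<^sub>R v x) * box_bump n a b x) \<in> borel_measurable lebesgue" for n
        using iv bump[of n] by (intro borel_measurable_times) (auto intro: measurable_completion)
      show "(\<lambda>x. (indicator (cbox a b) x *\<^sub>R v x) * indicator (box a b) x) \<in> borel_measurable lebesgue"
        using iv by (intro borel_measurable_times borel_measurable_indicator) auto
    qed (use iv in auto)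
    moreover have "(LINT x|lebesgue. (indicator (cbox a b) x *\<^sub>R v x) * indicator (box a b) x)
        = (LINT x:box a b|lebesgue. v x)"
      unfolding set_lebesgue_integral_def using box_subset_cbox[of a b]
      by (intro Bochner_Integration.integral_cong) (auto simp: indicator_def)
    moreover have "(LINT x|lebesgue. (indicator (cbox a b) x *\<^sub>R v x) * box_bump n a b x) = 0" for n
      using orth[OF box_bump_test_function[OF ab], of n] eq[of n] by simp
    ultimately show ?thesis
      by (simp add: LIMSEQ_const_iff)
  qed
  have AE_box: "AE x in lebesgue. x \<in> box c d \<longrightarrow> v x = 0" if cd: "cbox c d \<subseteq> box 0 1" for c d
  proof -
    let ?w = "\<lambda>x. indicator (box c d) x * v x"
    have iw: "integrable lebesgue ?w"
    proof -
      have "set_integrable lebesgue (cbox c d) v"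
        using loc cd unfolding locally_integrable_def interior_unit_cube by auto
      then have "set_integrable lebesgue (box c d) v"
        by (rule set_integrable_subset) (auto simp: box_subset_cbox)
      then show ?thesis by (simp add: set_integrable_def)
    qed
    obtain f where f: "f \<in> borel_measurable lborel" "AE x in lborel. ?w x = f x"
      using completion_ex_borel_measurable_real[of ?w lborel] iw by auto
    have f': "AE x in lebesgue. ?w x = f x"
      using f(2) by (rule AE_completion)
    have fm: "f \<in> borel_measurable lebesgue"
      using f(1) by (rule measurable_completion)
    have "integrable lebesgue f"
      using integrable_cong_AE_imp[OF iw fm f'] .
    then have fi: "integrable lborel f"
      using integrable_completion[OF f(1)] by simp
    have *: "(LINT x|lborel. indicator A x * f x) = (LINT x:A \<inter> box c d|lebesgue. v x)"
      if "A \<in> sets borel" for A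
    proof -
      have "(LINT x|lborel. indicator A x * f x) = (LINT x|lebesgue. indicator A x * f x)"
        using f(1) that by (subst integral_completion) auto
      also have "\<dots> = (LINT x|lebesgue. indicator A x * ?w x)"
      proof (rule integral_cong_AE)
        have A: "A \<in> sets lebesgue" using that by simp
        show "(\<lambda>x. indicator A x * f x) \<in> borel_measurable lebesgue"
          by (rule borel_measurable_times[OF borel_measurable_indicator[OF A] fm])
        show "(\<lambda>x. indicator A x * ?w x) \<in> borel_measurable lebesgue"
          by (rule borel_measurable_times[OF borel_measurable_indicator[OF A] borel_measurable_integrable[OF iw]])
        show "AE x in lebesgue. indicator A x * f x = indicator A x * ?w x"
          using f' by eventually_elim simp
      qed
      also have "\<dots> = (LINT x:A \<inter> box c d|lebesgue. v x)"
        unfolding set_lebesgue_integral_def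
        by (intro Bochner_Integration.integral_cong) (auto simp: indicator_def)
      finally show ?thesis .
    qed
    have "AE x in lborel. f x = 0"
    proof (rule AE_zero_if_box_integrals_zero[OF fi])
      show "(LINT x|lborel. f x) = 0"
        using *[of UNIV] box0[OF cd] by simp
    next
      fix a b :: "real ^ 'n"
      obtain a' b' where ab: "box a b \<inter> box c d = box a' b'" "cbox a b \<inter> cbox c d = cbox a' b'"
        by (rule that[OF box_Int_box Int_interval])
      then have "cbox a' b' \<subseteq> box 0 1" using cd by blast
      from box0[OF this] show "(LINT x:box a b|lborel. f x) = 0"
        using *[of "box a b"] ab by (simp add: set_lebesgue_integral_def)
    qed
    then have "AE x in lebesgue. f x = 0" by (rule AE_completion)
    with f' show ?thesis by eventually_elim (auto simp: indicator_def split: if_splits)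
  qed
  \<comment> \<open>Compact boxes that exhaust the open cube.\<close>
  define c :: "nat \<Rightarrow> real ^ 'n" where "c n = (\<chi> i. 1 / (real n + 2))" for n
  define d :: "nat \<Rightarrow> real ^ 'n" where "d n = (\<chi> i. 1 - 1 / (real n + 2))" for n
  have "AE x in lebesgue. x \<in> box (c n) (d n) \<longrightarrow> v x = 0" for n
  proof (rule AE_box, rule subsetI)
    fix x assume x: "x \<in> cbox (c n) (d n)"
    have "0 < x $ i \<and> x $ i < 1" for i
    proof -
      have "1 / (real n + 2) \<le> x $ i" "x $ i \<le> 1 - 1 / (real n + 2)"
        using x by (auto simp: mem_box_cart c_def d_def)
      moreover have "0 < 1 / (real n + 2)" by simp
      ultimately show ?thesis by linarith
    qed
    then show "x \<in> box 0 1" by (simp add: mem_box_cart)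
  qed
  then have "AE x in lebesgue. \<forall>n. x \<in> box (c n) (d n) \<longrightarrow> v x = 0"
    unfolding AE_all_countable by blast
  moreover have "\<exists>n. x \<in> box (c n) (d n)" if x: "x \<in> box 0 1" for x
  proof -
    have "eventually (\<lambda>n. 1 / (real n + 2) < x $ i \<and> x $ i < 1 - 1 / (real n + 2)) sequentially" for i
    proof -
      have "(\<lambda>n. 1 / (real n + 2)) \<longlonglongrightarrow> 0"
        using LIMSEQ_ignore_initial_segment[OF lim_inverse_n', of 2] by (simp add: add.commute)
      moreover have "0 < x $ i" "0 < 1 - x $ i"
        using x by (auto simp: mem_box_cart)
      ultimately have "eventually (\<lambda>n. 1 / (real n + 2) < x $ i) sequentially"
          "eventually (\<lambda>n. 1 / (real n + 2) < 1 - x $ i) sequentially"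
        by (blast dest: order_tendstoD(2))+
      then show ?thesis by eventually_elim auto
    qed
    then have "eventually (\<lambda>n. \<forall>i. 1 / (real n + 2) < x $ i \<and> x $ i < 1 - 1 / (real n + 2)) sequentially"
      by (rule eventually_all_finite)
    then show ?thesis
      by (auto simp: eventually_sequentially mem_box_cart c_def d_def)
  qed
  ultimately have 1: "AE x in lebesgue. x \<in> box 0 1 \<longrightarrow> v x = 0"
    by (elim eventually_mono) blast
  have "AE x in lebesgue. x \<notin> cbox 0 1 - box 0 (1::real ^ 'n)"
    using negligible_frontier_interval[of "0::real ^ 'n" 1] unfolding negligible_iff_null_sets by (rule AE_not_in)
  with 1 have "AE x in lebesgue. x \<in> unit_cube \<longrightarrow> v x = 0"
    by eventually_elim (auto simp: unit_cube_def)
  then show ?thesis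
    by (subst AE_restrict_space_iff) (auto simp: unit_cube_def)
qed

section \<open>Integration by parts for Lipschitz functions\<close>

lemma partial_deriv_along_line:
  fixes \<phi> :: "real ^ 'n \<Rightarrow> real"
  assumes "\<And>x. \<phi> differentiable at x"
  shows "((\<lambda>t. \<phi> (x + t *\<^sub>R axis i 1)) has_real_derivative partial_deriv i \<phi> (x + t *\<^sub>R axis i 1)) (at t)"
proof -
  let ?y = "x + t *\<^sub>R axis i 1"
  have 1: "((\<lambda>t. x + t *\<^sub>R axis i 1) has_derivative (\<lambda>h. h *\<^sub>R axis i 1)) (at t)"
    by (auto intro!: derivative_eq_intros)
  have 2: "(\<phi> has_derivative frechet_derivative \<phi> (at ?y)) (at ?y)"
    using assms frechet_derivative_works by blast
  then have "linear (frechet_derivative \<phi> (at ?y))"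
    by (rule has_derivative_linear)
  then have "frechet_derivative \<phi> (at ?y) (h *\<^sub>R axis i 1) = partial_deriv i \<phi> ?y * h" for h
    by (simp add: linear_scale partial_deriv_def)
  then show ?thesis
    using diff_chain_at[OF 1 2] by (simp add: o_def has_field_derivative_def mult_commute_abs)
qed

lemma integrable_continuous_compact_support:
  fixes f :: "real ^ 'n \<Rightarrow> real"
  assumes "continuous_on UNIV f" "compact S" "\<And>x. x \<notin> S \<Longrightarrow> f x = 0"
  shows "integrable lborel f"
proof -
  have "integrable lborel (\<lambda>x. indicator S x *\<^sub>R f x)"
    using assms by (intro borel_integrable_compact) (auto intro: continuous_on_subset)
  also have "(\<lambda>x. indicator S x *\<^sub>R f x) = f"
    using assms(3) by (force simp: indicator_def)
  finally show ?thesis .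
qed

lemma test_function_facts:
  fixes \<phi> :: "real ^ 'n \<Rightarrow> real"
  assumes "test_function \<phi>"
  shows test_function_continuous: "continuous_on UNIV \<phi>"
    and test_function_differentiable: "\<phi> differentiable at x"
    and test_function_continuous_partial: "continuous_on UNIV (partial_deriv i \<phi>)"
    and test_function_support: "x \<notin> unit_cube \<Longrightarrow> \<phi> x = 0"
    and test_function_partial_support: "x \<notin> unit_cube \<Longrightarrow> partial_deriv i \<phi> x = 0"
proof -
  have Ck: "Ck k \<phi>" for k using assms by (simp add: test_function_def)
  show "continuous_on UNIV \<phi>" using Ck[of 0] by simp
  show "\<phi> differentiable at x" for x using Ck[of 1] by simp
  show "continuous_on UNIV (partial_deriv i \<phi>)" using Ck[of 1] by simp
  have sub: "closure {x. \<phi> x \<noteq> 0} \<subseteq> unit_cube"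
    using assms interior_subset unfolding test_function_def by blast
  have zero: "\<phi> y = 0" if "y \<notin> closure {x. \<phi> x \<noteq> 0}" for y
    using that closure_subset[of "{x. \<phi> x \<noteq> 0}"] by auto
  have off: "x \<notin> unit_cube \<Longrightarrow> x \<notin> closure {x. \<phi> x \<noteq> 0}"
    using sub by (rule contra_subsetD)
  show "x \<notin> unit_cube \<Longrightarrow> \<phi> x = 0"
    by (rule zero[OF off])
  show "partial_deriv i \<phi> x = 0" if x: "x \<notin> unit_cube"
  proof -
    have "(\<phi> has_derivative (\<lambda>h. 0)) (at x)"
    proof (rule has_derivative_transform_within_open)
      show "((\<lambda>x. 0) has_derivative (\<lambda>h. 0)) (at x)" by simp
      show "open (- closure {x. \<phi> x \<noteq> 0})" by (rule open_Compl) (rule closed_closure)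
      show "x \<in> - closure {x. \<phi> x \<noteq> 0}" using off[OF x] by simp
    qed (rule zero[symmetric], erule ComplD)
    then have "(\<lambda>h. 0) = frechet_derivative \<phi> (at x)"
      by (rule frechet_derivative_at)
    from fun_cong[OF this[symmetric], of "axis i 1"] show ?thesis
      by (simp only: partial_deriv_def)
  qed
qed

lemma compact_unit_cube [simp]: "compact unit_cube"
  by (simp add: unit_cube_def)

text \<open>
  By translation invariance of Lebesgue measure a forward difference quotient of \<open>\<phi>\<close> can be exchanged
  for a backward difference quotient of \<open>v\<close>.  Both sides converge dominatedly: the quotients of \<open>\<phi>\<close> are
  bounded by the mean value theorem, those of \<open>v\<close> by the Lipschitz constant.  No iterated integrals
  and no fundamental theorem for Lipschitz functions are involved.
\<close>

lemma lipschitz_integration_by_parts: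
  fixes v :: "real ^ 'n \<Rightarrow> real"
  assumes lip: "\<And>x y. \<bar>v x - v y\<bar> \<le> L * norm (x - y)"
    and g: "g \<in> borel_measurable borel"
    and lim: "AE x in lborel. ((\<lambda>h. (v (x + h *\<^sub>R axis i 1) - v x) / h) \<longlongrightarrow> g x) (at 0)"
    and \<phi>: "test_function \<phi>"
  shows "(LINT x|lebesgue_on unit_cube. v x * partial_deriv i \<phi> x)
       = - (LINT x|lebesgue_on unit_cube. g x * \<phi> x)"
proof -
  let ?e = "axis i 1 :: real ^ 'n"
  let ?D = "partial_deriv i \<phi>"
  note cont = test_function_continuous[OF \<phi>] test_function_continuous_partial[OF \<phi>, of i]
  note supp = test_function_support[OF \<phi>] test_function_partial_support[OF \<phi>, of _ i]
  have L0: "0 \<le> L"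
  proof -
    have "\<bar>v 0 - v ?e\<bar> \<le> L" using lip[of 0 ?e] by (simp add: norm_axis_1)
    then show ?thesis by linarith
  qed
  have "L-lipschitz_on UNIV v"
    using lip L0 by (intro lipschitz_onI) (auto simp: dist_norm)
  then have vc: "continuous_on UNIV v" by (rule lipschitz_on_continuous_on)
  have bm [measurable]: "v \<in> borel_measurable borel" "\<phi> \<in> borel_measurable borel" "?D \<in> borel_measurable borel"
    using vc cont by (auto intro: borel_measurable_continuous_onI)
  note g [measurable]
  obtain C where C: "\<And>x. \<bar>?D x\<bar> \<le> C" "0 \<le> C"
  proof -
    have "bounded (?D ` unit_cube)"
      using cont(2) by (intro compact_imp_bounded compact_continuous_image) (auto intro: continuous_on_subset)
    then obtain C where "\<And>x. x \<in> unit_cube \<Longrightarrow> \<bar>?D x\<bar> \<le> C"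
      by (auto simp: bounded_iff)
    then have "\<bar>?D x\<bar> \<le> max C 0" for x
      using supp(2)[of x] by (cases "x \<in> unit_cube") (auto simp: le_max_iff_disj)
    then show ?thesis using that[of "max C 0"] by simp
  qed
  have mvt: "\<bar>\<phi> (x + h *\<^sub>R ?e) - \<phi> x\<bar> \<le> C * h" if hpos: "h > 0" for x h
  proof -
    obtain z where "\<phi> (x + h *\<^sub>R ?e) - \<phi> (x + 0 *\<^sub>R ?e) = (h - 0) * ?D (x + z *\<^sub>R ?e)"
      using MVT2[OF hpos, of "\<lambda>t. \<phi> (x + t *\<^sub>R ?e)" "\<lambda>t. ?D (x + t *\<^sub>R ?e)"]
        partial_deriv_along_line[OF test_function_differentiable[OF \<phi>]] by blast
    then show ?thesis using C hpos by (simp add: abs_mult mult.commute mult_left_mono)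
  qed
  define h where "h n = 1 / real (Suc n)" for n
  have h: "h n > 0" "h n \<le> 1" for n by (auto simp: h_def)
  have h0: "h \<longlonglongrightarrow> 0"
    unfolding h_def by (rule LIMSEQ_inverse_real_of_nat[unfolded inverse_eq_divide])
  let ?P = "\<lambda>n x. v x * ((\<phi> (x + h n *\<^sub>R ?e) - \<phi> x) / h n)"
  let ?Q = "\<lambda>n x. ((v (x - h n *\<^sub>R ?e) - v x) / h n) * \<phi> x"
  have swap: "(LINT x|lborel. ?P n x) = (LINT x|lborel. ?Q n x)" for n
  proof -
    have i1: "integrable lborel (\<lambda>x. v x * \<phi> x)"
      by (rule integrable_continuous_compact_support[of _ unit_cube])
         (auto intro!: continuous_intros vc cont simp: supp)
    have i2: "integrable lborel (\<lambda>x. v (x - h n *\<^sub>R ?e) * \<phi> x)"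
      by (rule integrable_continuous_compact_support[of _ unit_cube])
         (auto intro!: continuous_intros continuous_on_compose2[OF vc] cont simp: supp)
    have shift: "distr lborel borel ((+) (h n *\<^sub>R ?e)) = lborel"
      by (rule lborel_distr_plus)
    have i3: "integrable lborel (\<lambda>x. v x * \<phi> (x + h n *\<^sub>R ?e))"
      using i2 by (subst (asm) shift[symmetric], subst (asm) integrable_distr_eq) (auto simp: add.commute)
    have e3: "(LINT x|lborel. v x * \<phi> (x + h n *\<^sub>R ?e)) = (LINT x|lborel. v (x - h n *\<^sub>R ?e) * \<phi> x)"
      by (subst (2) shift[symmetric], subst integral_distr) (auto simp: add.commute)
    have "(LINT x|lborel. ?P n x) = (LINT x|lborel. (v x * \<phi> (x + h n *\<^sub>R ?e) - v x * \<phi> x) / h n)"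
      by (simp add: algebra_simps)
    also have "\<dots> = ((LINT x|lborel. v (x - h n *\<^sub>R ?e) * \<phi> x) - (LINT x|lborel. v x * \<phi> x)) / h n"
      using i1 i3 e3 by simp
    also have "\<dots> = (LINT x|lborel. (v (x - h n *\<^sub>R ?e) * \<phi> x - v x * \<phi> x) / h n)"
      using i1 i2 by simp
    also have "\<dots> = (LINT x|lborel. ?Q n x)"
      by (simp add: algebra_simps)
    finally show ?thesis .
  qed
  have at0: "filterlim h (at 0) sequentially"
    using h0 h(1) by (auto simp: filterlim_at less_imp_neq[symmetric] intro!: always_eventually)
  have Plim: "(\<lambda>n. LINT x|lborel. ?P n x) \<longlonglongrightarrow> (LINT x|lborel. v x * ?D x)"
  proof (rule integral_dominated_convergence[where w = "\<lambda>x. indicator (cbox (-1) 2) x *\<^sub>R (\<bar>v x\<bar> * C)"])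
    \<comment> \<open>A shift by at most \<open>1\<close> moves the support of \<open>\<phi>\<close> at most into the cube \<open>[-1, 2]\<^sup>n\<close>.\<close>
    show "integrable lborel (\<lambda>x. indicator (cbox (-1) (2 :: real ^ 'n)) x *\<^sub>R (\<bar>v x\<bar> * C))"
      by (intro borel_integrable_compact) (auto intro!: continuous_intros continuous_on_subset[OF vc])
    show "AE x in lborel. (\<lambda>n. ?P n x) \<longlonglongrightarrow> v x * ?D x"
    proof (intro AE_I2 tendsto_mult_left)
      fix x
      have "((\<lambda>t. \<phi> (x + t *\<^sub>R ?e)) has_real_derivative ?D x) (at 0)"
        using partial_deriv_along_line[OF test_function_differentiable[OF \<phi>], of x i 0] by simp
      then have "((\<lambda>t. (\<phi> (x + t *\<^sub>R ?e) - \<phi> x) / t) \<longlongrightarrow> ?D x) (at 0)"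
        by (simp add: DERIV_def)
      from filterlim_compose[OF this at0]
      show "(\<lambda>n. (\<phi> (x + h n *\<^sub>R ?e) - \<phi> x) / h n) \<longlonglongrightarrow> ?D x" .
    qed
    show "AE x in lborel. norm (?P n x) \<le> indicator (cbox (-1) 2) x *\<^sub>R (\<bar>v x\<bar> * C)" for n
    proof (intro AE_I2)
      fix x
      show "norm (?P n x) \<le> indicator (cbox (-1) 2) x *\<^sub>R (\<bar>v x\<bar> * C)"
      proof (cases "x \<in> cbox (-1) 2")
        case True
        have "\<bar>(\<phi> (x + h n *\<^sub>R ?e) - \<phi> x) / h n\<bar> \<le> C"
          using mvt[OF h(1)[of n], of x] h(1)[of n] by (simp add: field_simps)
        from mult_left_mono[OF this abs_ge_zero[of "v x"]] show ?thesis
          using True unfolding real_norm_def abs_mult by simp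
      next
        case False
        then obtain j where j: "\<not> (-1 \<le> x $ j \<and> x $ j \<le> 2)"
          unfolding mem_box_cart by auto
        have cube: "y \<notin> unit_cube" if "\<not> (0 \<le> y $ j \<and> y $ j \<le> 1)" for y :: "real ^ 'n"
          using that unfolding unit_cube_def mem_box_cart by auto
        have "\<not> (0 \<le> x $ j \<and> x $ j \<le> 1)" using j by linarith
        moreover have "\<not> (0 \<le> (x + h n *\<^sub>R ?e) $ j \<and> (x + h n *\<^sub>R ?e) $ j \<le> 1)"
          using j h[of n] by (cases "i = j") (simp_all add: axis_def, linarith+)
        ultimately have "x \<notin> unit_cube" "x + h n *\<^sub>R ?e \<notin> unit_cube"
          using cube by blast+
        then show ?thesis using C(2) by (simp add: supp)
      qed
    qed
  qed measurable
  have Qlim: "(\<lambda>n. LINT x|lborel. ?Q n x) \<longlonglongrightarrow> (LINT x|lborel. - (g x * \<phi> x))"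
  proof (rule integral_dominated_convergence[where w = "\<lambda>x. L * \<bar>\<phi> x\<bar>"])
    show "integrable lborel (\<lambda>x. L * \<bar>\<phi> x\<bar>)"
      by (rule integrable_continuous_compact_support[of _ unit_cube])
         (auto intro!: continuous_intros cont simp: supp)
    have at0': "filterlim (\<lambda>n. - h n) (at 0) sequentially"
      using tendsto_minus[OF h0] h(1) by (auto simp: filterlim_at less_imp_neq[symmetric] intro!: always_eventually)
    show "AE x in lborel. (\<lambda>n. ?Q n x) \<longlonglongrightarrow> - (g x * \<phi> x)"
      using lim
    proof eventually_elim
      case (elim x)
      from filterlim_compose[OF elim at0']
      have "(\<lambda>n. - ((v (x + (- h n) *\<^sub>R ?e) - v x) / (- h n)) * \<phi> x) \<longlonglongrightarrow> - g x * \<phi> x"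
        by (intro tendsto_mult tendsto_minus tendsto_const)
      then show ?case by simp
    qed
    show "AE x in lborel. norm (?Q n x) \<le> L * \<bar>\<phi> x\<bar>" for n
    proof (intro AE_I2)
      fix x
      have "\<bar>v (x - h n *\<^sub>R ?e) - v x\<bar> \<le> L * h n"
        using lip[of "x - h n *\<^sub>R ?e" x] h(1)[of n] by (simp add: norm_axis_1)
      then have "\<bar>(v (x - h n *\<^sub>R ?e) - v x) / h n\<bar> \<le> L"
        using h(1)[of n] by (simp add: field_simps)
      then show "norm (?Q n x) \<le> L * \<bar>\<phi> x\<bar>"
        unfolding real_norm_def abs_mult by (rule mult_right_mono) simp
    qed
  qed measurable
  have "(LINT x|lborel. v x * ?D x) = (LINT x|lborel. - (g x * \<phi> x))"
    using Plim Qlim unfolding swap by (rule LIMSEQ_unique)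
  moreover have "(LINT x|lebesgue_on unit_cube. f x) = (LINT x|lborel. f x)"
    if "f \<in> borel_measurable borel" "\<And>x. x \<notin> unit_cube \<Longrightarrow> f x = 0" for f :: "real ^ 'n \<Rightarrow> real"
    using LINT_unit_cube[of f] integral_completion[of f lborel] that by simp
  from this[of "\<lambda>x. v x * ?D x"] this[of "\<lambda>x. g x * \<phi> x"]
  have "(LINT x|lebesgue_on unit_cube. v x * ?D x) = (LINT x|lborel. v x * ?D x)"
    "(LINT x|lebesgue_on unit_cube. g x * \<phi> x) = (LINT x|lborel. g x * \<phi> x)"
    by (simp_all add: supp)
  ultimately show ?thesis by simp
qed

section \<open>Orthogonality and completeness of the cosine modes\<close>

lemma vec_nth_lborel_decomposition:
  "(\<Sum>b\<in>Basis. g b *\<^sub>R b) $ i = g (axis i (1::real))"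
proof -
  have "(\<Sum>b\<in>Basis. g b *\<^sub>R b) $ i = (\<Sum>b\<in>Basis. g b *\<^sub>R b) \<bullet> axis i 1"
    by (simp add: inner_axis)
  also have "\<dots> = g (axis i 1)"
    by (rule inner_sum_left_Basis) (auto simp: Basis_vec_def)
  finally show ?thesis .
qed

lemma integrable_lebesgue_on_unit_cube:
  fixes f :: "real ^ 'n \<Rightarrow> real"
  assumes "continuous_on UNIV f"
  shows "integrable (lebesgue_on unit_cube) f"
proof -
  have "f absolutely_integrable_on unit_cube"
    using assms unfolding unit_cube_def
    by (intro absolutely_integrable_continuous) (auto intro: continuous_on_subset)
  then show ?thesis
    by (subst integrable_restrict_space) (auto simp: set_integrable_def unit_cube_def)
qed

text \<open>
  Lebesgue measure is the image of a product measure indexed by the basis vectors, where the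
  integral of a product of functions of one coordinate each splits.
\<close>

lemma LINT_unit_cube_prod:
  fixes f :: "'n::finite \<Rightarrow> real \<Rightarrow> real"
  assumes cont: "\<And>i. continuous_on UNIV (f i)"
  shows "(LINT x|lebesgue_on unit_cube. (\<Prod>i\<in>UNIV. f i (x $ i))) = (\<Prod>i\<in>UNIV. integral {0..1} (f i))"
proof -
  define h where "h i t = indicator {0..1} t * f i t" for i and t :: real
  have fm [measurable]: "f i \<in> borel_measurable borel" for i
    using cont by (rule borel_measurable_continuous_onI)
  have hm [measurable]: "h i \<in> borel_measurable borel" for i
    unfolding h_def by measurable
  have hi: "integrable lborel (h i)" for i
  proof -
    have "integrable lborel (\<lambda>t. indicator {0..1} t *\<^sub>R f i t)"
      using cont by (intro borel_integrable_compact) (auto intro: continuous_on_subset)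
    then show ?thesis by (simp add: h_def[abs_def])
  qed
  have h1: "(LINT t|lborel. h i t) = integral {0..1} (f i)" for i
  proof -
    have "set_integrable lborel {0..1} (f i)"
      using hi[of i] by (simp add: set_integrable_def h_def[abs_def])
    then have "(LINT t:{0..1}|lborel. f i t) = integral {0..1} (f i)"
      by (rule set_borel_integral_eq_integral)
    then show ?thesis by (simp add: set_lebesgue_integral_def h_def)
  qed
  have cube: "indicator unit_cube x = (\<Prod>i\<in>UNIV. indicator {0..1} (x $ i) :: real)" for x :: "real ^ 'n"
    by (auto simp: indicator_def unit_cube_def mem_box_cart)
  interpret product_sigma_finite "\<lambda>_ :: real ^ 'n. lborel :: real measure"
    by standard
  have bij: "bij_betw (\<lambda>i. axis i 1) UNIV (Basis :: (real ^ 'n) set)"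
    by (auto simp: bij_betw_def inj_on_def axis_eq_axis Basis_vec_def)
  define idx where "idx b = the_inv_into UNIV (\<lambda>i. axis i (1::real) :: real ^ 'n) b" for b
  have idx: "idx (axis i 1) = i" for i
    unfolding idx_def by (rule the_inv_into_f_f) (auto simp: inj_on_def axis_eq_axis)
  have m1: "(\<lambda>x :: real ^ 'n. \<Prod>i\<in>UNIV. f i (x $ i)) \<in> borel_measurable borel"
    by measurable
  have m2: "(\<lambda>x :: real ^ 'n. \<Prod>i\<in>UNIV. h i (x $ i)) \<in> borel_measurable borel"
    by measurable
  have "(LINT x|lebesgue_on unit_cube. (\<Prod>i\<in>UNIV. f i (x $ i)))
      = (LINT x|lebesgue. indicator unit_cube x *\<^sub>R (\<Prod>i\<in>UNIV. f i (x $ i)))"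
    by (intro integral_restrict_space) (auto simp: unit_cube_def)
  also have "\<dots> = (LINT x|lebesgue. (\<Prod>i\<in>UNIV. h i (x $ i)))"
    by (simp add: cube h_def prod.distrib)
  also have "\<dots> = (LINT x|lborel. (\<Prod>i\<in>UNIV. h i (x $ i)))"
    using m2 by (intro integral_completion) simp
  also have "\<dots> = (LINT g|(\<Pi>\<^sub>M b\<in>Basis. lborel). (\<Prod>i\<in>UNIV. h i ((\<Sum>b\<in>Basis. g b *\<^sub>R b) $ i)))"
    by (subst lborel_eq, subst integral_distr) (use m2 in auto)
  also have "\<dots> = (LINT g|(\<Pi>\<^sub>M b\<in>Basis. lborel). (\<Prod>b\<in>Basis. h (idx b) (g b)))"
  proof (intro Bochner_Integration.integral_cong refl)
    fix g :: "real ^ 'n \<Rightarrow> real"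
    have "(\<Prod>b\<in>Basis. h (idx b) (g b)) = (\<Prod>i\<in>UNIV. h i (g (axis i 1)))"
      by (subst prod.reindex_bij_betw[OF bij, symmetric]) (simp add: idx)
    then show "(\<Prod>i\<in>UNIV. h i ((\<Sum>b\<in>Basis. g b *\<^sub>R b) $ i)) = (\<Prod>b\<in>Basis. h (idx b) (g b))"
      by (simp only: vec_nth_lborel_decomposition)
  qed
  also have "\<dots> = (\<Prod>b\<in>Basis. LINT t|lborel. h (idx b) t)"
    by (intro product_integral_prod hi) auto
  also have "\<dots> = (\<Prod>i\<in>UNIV. integral {0..1} (f i))"
    by (subst prod.reindex_bij_betw[OF bij, symmetric]) (simp add: idx h1)
  finally show ?thesis .
qed

lemma has_integral_cos_pi:
  fixes n :: int
  assumes "n \<noteq> 0"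
  shows "((\<lambda>t. cos (pi * of_int n * t)) has_integral 0) {0..1}"
proof -
  have "((\<lambda>t. cos (pi * of_int n * t)) has_integral
      (sin (pi * of_int n * 1) / (pi * of_int n) - sin (pi * of_int n * 0) / (pi * of_int n))) {0..1}"
    using assms
    by (intro fundamental_theorem_of_calculus)
       (auto intro!: derivative_eq_intros simp: has_real_derivative_iff_has_vector_derivative[symmetric])
  then show ?thesis by (simp add: sin_npi_int mult.commute)
qed

lemma integral_cos_cos:
  fixes k j :: nat
  shows "integral {0..1} (\<lambda>t. cos (pi * real k * t) * cos (pi * real j * t)) =
    (if k \<noteq> j then 0 else if k = 0 then 1 else 1 / 2)"
proof -
  have eq: "cos (pi * real k * t) * cos (pi * real j * t) =
    (cos (pi * of_int (int k - int j) * t) + cos (pi * of_int (int k + int j) * t)) / 2" for t :: real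
  proof -
    have "pi * real k * t - pi * real j * t = pi * of_int (int k - int j) * t"
      "pi * real k * t + pi * real j * t = pi * of_int (int k + int j) * t"
      by (simp_all add: left_diff_distrib right_diff_distrib distrib_left distrib_right)
    then show ?thesis by (simp only: cos_times_cos)
  qed
  have 1: "((\<lambda>t::real. 1::real) has_integral 1) {0..1}"
    using has_integral_const_real[of "1::real" 0 1] by simp
  have "((\<lambda>t. (cos (pi * of_int (int k - int j) * t) + cos (pi * of_int (int k + int j) * t)) / 2)
     has_integral (if k \<noteq> j then 0 else if k = 0 then 1 else 1 / 2)) {0..1}"
  proof (cases "k = j")
    case False
    then show ?thesis
      using has_integral_divide[OF has_integral_add[OF
         has_integral_cos_pi[of "int k - int j"] has_integral_cos_pi[of "int k + int j"]], of 2] by simp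
  next
    case True
    show ?thesis
    proof (cases "k = 0")
      case True
      with \<open>k = j\<close> show ?thesis using 1 by simp
    next
      case False
      with \<open>k = j\<close> show ?thesis
        using has_integral_divide[OF has_integral_add[OF
         1 has_integral_cos_pi[of "int k + int j"]], of 2] by simp
    qed
  qed
  then show ?thesis
    unfolding eq by (rule integral_unique)
qed

lemma continuous_on_cos_mode [continuous_intros]: "continuous_on A (cos_mode k)"
  unfolding cos_mode_def by (intro continuous_intros)

lemma cos_mode_orthogonal:
  fixes k j :: "nat ^ 'n"
  assumes "k \<noteq> j"
  shows "(LINT x|lebesgue_on unit_cube. cos_mode k x * cos_mode j x) = 0"
proof -
  obtain i where i: "k $ i \<noteq> j $ i" using assms by (auto simp: vec_eq_iff)
  have "(LINT x|lebesgue_on unit_cube. cos_mode k x * cos_mode j x) =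
     (\<Prod>i\<in>UNIV. integral {0..1} (\<lambda>t. cos (pi * real (k $ i) * t) * cos (pi * real (j $ i) * t)))"
    unfolding cos_mode_def prod.distrib[symmetric]
    by (rule LINT_unit_cube_prod) (intro continuous_intros)
  also have "\<dots> = 0"
    by (rule prod_zero[OF finite], rule bexI[of _ i]) (simp_all add: integral_cos_cos i)
  finally show ?thesis .
qed

lemma cos_mode_square_integral_pos:
  fixes k :: "nat ^ 'n"
  shows "(LINT x|lebesgue_on unit_cube. (cos_mode k x)\<^sup>2) > 0"
proof -
  have "(LINT x|lebesgue_on unit_cube. (cos_mode k x)\<^sup>2) =
     (\<Prod>i\<in>UNIV. integral {0..1} (\<lambda>t. cos (pi * real (k $ i) * t) * cos (pi * real (k $ i) * t)))"
    unfolding cos_mode_def power2_eq_square prod.distrib[symmetric]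
    by (rule LINT_unit_cube_prod) (intro continuous_intros)
  also have "\<dots> > 0"
    by (auto simp: integral_cos_cos intro!: prod_pos)
  finally show ?thesis .
qed

inductive_set cos_span :: "(real ^ 'n \<Rightarrow> real) set" where
  mode: "cos_mode k \<in> cos_span"
| add: "f \<in> cos_span \<Longrightarrow> g \<in> cos_span \<Longrightarrow> (\<lambda>x. f x + g x) \<in> cos_span"
| scale: "f \<in> cos_span \<Longrightarrow> (\<lambda>x. c * f x) \<in> cos_span"

lemma cos_span_continuous: "f \<in> cos_span \<Longrightarrow> continuous_on A f"
  by (induction rule: cos_span.induct) (auto intro!: continuous_intros)

text \<open>
  The product formula \<open>2 cos \<alpha> cos \<beta> = cos (\<alpha> - \<beta>) + cos (\<alpha> + \<beta>)\<close> moves the frequency in coordinate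
  \<open>i\<close> one step down and one step up.
\<close>

lemma cos_span_times_cos:
  assumes "f \<in> cos_span"
  shows "(\<lambda>x. cos (pi * x $ i) * f x) \<in> cos_span"
  using assms
proof induction
  case (mode k)
  define up where "up = (\<chi> j. if j = i then Suc (k $ j) else k $ j)"
  define dn where "dn = (\<chi> j. if j = i then k $ j - 1 else k $ j)"
  have split: "cos_mode l x = cos (pi * real (l $ i) * x $ i) *
      (\<Prod>j\<in>UNIV - {i}. cos (pi * real (k $ j) * x $ j))"
    if "\<And>j. j \<noteq> i \<Longrightarrow> l $ j = k $ j" for l x
    unfolding cos_mode_def using that by (subst prod.remove[of _ i]) (auto intro!: prod.cong)
  show ?case
  proof (cases "k $ i = 0")
    case True
    then have "(\<lambda>x. cos (pi * x $ i) * cos_mode k x) = cos_mode up"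
      by (intro ext) (simp add: split up_def)
    then show ?thesis by (simp add: cos_span.mode)
  next
    case False
    have "(\<lambda>x. cos (pi * x $ i) * cos_mode k x) = (\<lambda>x. 1 / 2 * cos_mode up x + 1 / 2 * cos_mode dn x)"
    proof
      fix x
      have "cos (pi * x $ i) * cos (pi * real (k $ i) * x $ i) =
        1 / 2 * cos (pi * real (up $ i) * x $ i) + 1 / 2 * cos (pi * real (dn $ i) * x $ i)"
      proof -
        have "pi * x $ i - pi * real (k $ i) * x $ i = - (pi * real (dn $ i) * x $ i)"
          "pi * x $ i + pi * real (k $ i) * x $ i = pi * real (up $ i) * x $ i"
          using False by (simp_all add: up_def dn_def of_nat_diff algebra_simps)
        then show ?thesis by (simp only: cos_times_cos cos_minus) simp
      qed
      moreover define P where "P = (\<Prod>j\<in>UNIV - {i}. cos (pi * real (k $ j) * x $ j))"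
      moreover have "cos_mode k x = cos (pi * real (k $ i) * x $ i) * P"
        "cos_mode up x = cos (pi * real (up $ i) * x $ i) * P"
        "cos_mode dn x = cos (pi * real (dn $ i) * x $ i) * P"
        unfolding P_def by (rule split; simp add: up_def dn_def)+
      ultimately show "cos (pi * x $ i) * cos_mode k x = 1 / 2 * cos_mode up x + 1 / 2 * cos_mode dn x"
        by (simp only: mult.assoc[symmetric] distrib_right)
    qed
    moreover have "(\<lambda>x. 1 / 2 * cos_mode up x + 1 / 2 * cos_mode dn x) \<in> cos_span"
      by (intro cos_span.add cos_span.scale cos_span.mode)
    ultimately show ?thesis by (simp only:)
  qed
next
  case (add f g)
  then show ?case using cos_span.add by (simp add: distrib_left)
next
  case (scale f c)
  then show ?case using cos_span.scale[of "\<lambda>x. cos (pi * x $ i) * f x" c] by (simp add: mult.left_commute)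
qed

text \<open>
  Closure of the span under arbitrary products would require a product formula for two general modes.
  It is enough to apply the Stone--Weierstrass theorem to the multipliers of the span: they
  form an algebra for trivial reasons, they contain the functions \<open>cos (pi x\<^sub>i)\<close>, which separate points
  because the cosine is injective on \<open>[0, pi]\<close>, and they lie in the span because \<open>1\<close> does.
\<close>

lemma cos_span_uniformly_dense:
  fixes \<phi> :: "real ^ 'n \<Rightarrow> real"
  assumes "continuous_on unit_cube \<phi>" "e > 0"
  shows "\<exists>g\<in>cos_span. \<forall>x\<in>unit_cube. \<bar>\<phi> x - g x\<bar> < e"
proof -
  define R :: "(real ^ 'n \<Rightarrow> real) set"
    where "R = {f. continuous_on UNIV f \<and> (\<forall>g\<in>cos_span. (\<lambda>x. f x * g x) \<in> cos_span)}"
  interpret function_ring_on R "unit_cube :: (real ^ 'n) set"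
  proof
    show "(\<lambda>x. f x * g x) \<in> R" if "f \<in> R" "g \<in> R" for f g
      using that by (auto simp: R_def mult.assoc intro!: continuous_intros)
    show "(\<lambda>x. f x + g x) \<in> R" if "f \<in> R" "g \<in> R" for f g
      using that by (auto simp: R_def distrib_right intro!: continuous_intros cos_span.add)
    show "\<exists>f\<in>R. f x \<noteq> f y" if xy: "x \<in> unit_cube" "y \<in> unit_cube" "x \<noteq> y" for x y
    proof -
      obtain i where i: "x $ i \<noteq> y $ i" using xy(3) by (auto simp: vec_eq_iff)
      have "(\<lambda>x. cos (pi * x $ i)) \<in> R"
        by (auto simp: R_def intro!: continuous_intros cos_span_times_cos)
      moreover have "cos (pi * x $ i) \<noteq> cos (pi * y $ i)"
      proof
        assume eq: "cos (pi * x $ i) = cos (pi * y $ i)"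
        have range: "0 \<le> pi * z $ i" "pi * z $ i \<le> pi" if "z \<in> unit_cube" for z :: "real ^ 'n"
          using that mult_left_mono[of "z $ i" 1 pi] by (auto simp: unit_cube_def mem_box_cart)
        have "pi * x $ i = pi * y $ i"
          by (rule cos_inj_pi[OF range[OF xy(1)] range[OF xy(2)] eq])
        then show False using i by simp
      qed
      ultimately show ?thesis by (intro bexI[of _ "\<lambda>x. cos (pi * x $ i)"])
    qed
    show "continuous_on unit_cube f" if "f \<in> R" for f
      using that by (auto simp: R_def intro: continuous_on_subset)
    show "(\<lambda>_. c) \<in> R" for c
      by (simp add: R_def cos_span.scale)
  qed (rule compact_unit_cube)
  obtain g where g: "g \<in> R" "\<forall>x\<in>unit_cube. \<bar>\<phi> x - g x\<bar> < e"
    using Stone_Weierstrass_basic[OF assms] by blast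
  have "cos_mode 0 = (\<lambda>x :: real ^ 'n. 1)"
    by (intro ext) (simp add: cos_mode_def)
  then have "(\<lambda>x :: real ^ 'n. 1) \<in> cos_span"
    using cos_span.mode[of "0 :: nat ^ 'n"] by (simp only:)
  moreover have "\<forall>h\<in>cos_span. (\<lambda>x. g x * h x) \<in> cos_span"
    using g(1) by (simp add: R_def)
  ultimately have "(\<lambda>x. g x * 1) \<in> cos_span" by (rule bspec[rotated])
  then have "g \<in> cos_span" by simp
  with g(2) show ?thesis by blast
qed

lemma finite_measure_unit_cube: "finite_measure (lebesgue_on (unit_cube :: (real ^ 'n) set))"
  by (rule finite_measure_lebesgue_on) (simp add: unit_cube_def)

lemma integrable_unit_cube_locally:
  fixes v :: "real ^ 'n \<Rightarrow> 'b::euclidean_space"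
  assumes "integrable (lebesgue_on unit_cube) v"
  shows "locally_integrable v"
proof -
  have "set_integrable lebesgue unit_cube v"
    using assms unfolding set_integrable_def by (subst (asm) integrable_restrict_space) (auto simp: unit_cube_def)
  then have "set_integrable lebesgue K v" if "compact K" "K \<subseteq> interior unit_cube" for K
    by (rule set_integrable_subset) (use that interior_subset in \<open>auto dest: lmeasurable_compact fmeasurableD\<close>)
  then show ?thesis
    by (simp add: locally_integrable_def)
qed

text \<open>
  Test functions are continuous, hence uniform limits of combinations of modes.
\<close>

lemma cos_mode_orthogonal_imp_zero:
  fixes v :: "real ^ 'n \<Rightarrow> real"
  assumes int: "integrable (lebesgue_on unit_cube) v"
    and orth: "\<And>k. (LINT x|lebesgue_on unit_cube. v x * cos_mode k x) = 0"
  shows "AE x in lebesgue_on unit_cube. v x = 0"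
proof (rule test_function_orthogonal_imp_zero)
  show "locally_integrable v" using int by (rule integrable_unit_cube_locally)
  let ?M = "lebesgue_on (unit_cube :: (real ^ 'n) set)"
  have iv: "integrable ?M (\<lambda>x. v x * f x)" if f: "continuous_on UNIV f" for f
  proof -
    have "bounded (f ` unit_cube)"
      using f by (intro compact_imp_bounded compact_continuous_image) (auto intro: continuous_on_subset)
    then obtain C where C: "\<And>x. x \<in> unit_cube \<Longrightarrow> \<bar>f x\<bar> \<le> C" by (auto simp: bounded_iff)
    have fm: "f \<in> borel_measurable ?M"
      using integrable_lebesgue_on_unit_cube[OF f] by simp
    show ?thesis
    proof (rule Bochner_Integration.integrable_bound[of ?M "\<lambda>x. C * v x"])
      show "integrable ?M (\<lambda>x. C * v x)" using int by simp
      show "(\<lambda>x. v x * f x) \<in> borel_measurable ?M"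
        by (rule borel_measurable_times[OF borel_measurable_integrable[OF int] fm])
      show "AE x in ?M. norm (v x * f x) \<le> norm (C * v x)"
      proof (rule AE_I2)
        fix x assume "x \<in> space ?M"
        then have "\<bar>f x\<bar> \<le> \<bar>C\<bar>" using C[of x] by (simp add: order_trans[OF _ abs_ge_self])
        from mult_right_mono[OF this, of "\<bar>v x\<bar>"] show "norm (v x * f x) \<le> norm (C * v x)"
          by (simp add: abs_mult mult.commute)
      qed
    qed
  qed
  have span: "(LINT x|?M. v x * g x) = 0" if "g \<in> cos_span" for g
    using that
  proof induction
    case (add f g)
    then show ?case using iv[OF cos_span_continuous] by (simp add: distrib_left)
  next
    case (scale f c)
    then show ?case by (simp add: mult.left_commute)
  qed (rule orth)
  fix \<phi> :: "real ^ 'n \<Rightarrow> real" assume "test_function \<phi>"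
  then have cont: "continuous_on UNIV \<phi>" by (rule test_function_continuous)
  have "\<bar>LINT x|?M. v x * \<phi> x\<bar> \<le> 0 + e" if epos: "e > 0" for e
  proof -
    define I where "I = (LINT x|?M. \<bar>v x\<bar>)"
    have I0: "0 \<le> I" unfolding I_def by simp
    obtain g where g: "g \<in> cos_span" "\<forall>x\<in>unit_cube. \<bar>\<phi> x - g x\<bar> < e / (I + 1)"
      using cos_span_uniformly_dense[OF continuous_on_subset[OF cont], of "e / (I + 1)"] epos I0 by auto
    have "(LINT x|?M. v x * \<phi> x) = (LINT x|?M. v x * \<phi> x - v x * g x)"
      using iv[OF cont] iv[OF cos_span_continuous[OF g(1)]] span[OF g(1)] by simp
    also have "\<bar>\<dots>\<bar> \<le> (LINT x|?M. \<bar>v x * \<phi> x - v x * g x\<bar>)"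
      by (rule integral_abs_bound)
    also have "\<dots> \<le> (LINT x|?M. e / (I + 1) * \<bar>v x\<bar>)"
    proof (rule integral_mono)
      show "integrable ?M (\<lambda>x. \<bar>v x * \<phi> x - v x * g x\<bar>)"
        using iv[OF cont] iv[OF cos_span_continuous[OF g(1)]] by simp
      show "\<bar>v x * \<phi> x - v x * g x\<bar> \<le> e / (I + 1) * \<bar>v x\<bar>" if "x \<in> space ?M" for x
      proof -
        have "\<bar>\<phi> x - g x\<bar> \<le> e / (I + 1)" using g(2) that by (auto intro: less_imp_le)
        from mult_right_mono[OF this abs_ge_zero[of "v x"]] show ?thesis
          unfolding right_diff_distrib[symmetric] abs_mult by (simp only: mult.commute)
      qed
    qed (use int in simp)
    also have "\<dots> = e * (I / (I + 1))" by (simp add: I_def)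
    also have "\<dots> \<le> e" using I0 epos by (intro mult_left_le) auto
    finally show ?thesis by simp
  qed
  then have "\<bar>LINT x|?M. v x * \<phi> x\<bar> \<le> 0" by (rule field_le_epsilon)
  then show "(LINT x|?M. v x * \<phi> x) = 0" by simp
qed

section \<open>The cosine series of a Barron function\<close>

lemma integral_bounded_series:
  fixes f :: "nat \<Rightarrow> 'a \<Rightarrow> 'b::{banach, second_countable_topology}"
  assumes M: "finite_measure M"
    and meas: "\<And>n. f n \<in> borel_measurable M"
    and bound: "\<And>n x. x \<in> space M \<Longrightarrow> norm (f n x) \<le> A n"
    and A: "summable A"
  shows "integrable M (\<lambda>x. \<Sum>n. f n x)"
    and "(\<lambda>n. LINT x|M. f n x) sums (LINT x|M. (\<Sum>n. f n x))"
proof -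
  interpret finite_measure M by fact
  have int: "integrable M (f n)" for n
    by (rule integrable_const_bound[of _ "A n"]) (auto intro!: AE_I2 bound meas)
  have ae: "AE x in M. summable (\<lambda>n. norm (f n x))"
    by (intro AE_I2 summable_comparison_test'[OF A, of 0]) (simp add: bound)
  have "norm (LINT x|M. norm (f n x)) \<le> A n * measure M (space M)" for n
  proof -
    have "(LINT x|M. norm (f n x)) \<le> (LINT x|M. A n)"
      by (intro integral_mono integrable_norm int) (auto simp: bound)
    then show ?thesis by (simp add: mult.commute)
  qed
  then have sm: "summable (\<lambda>n. LINT x|M. norm (f n x))"
    by (intro summable_comparison_test'[OF summable_mult2[OF A, of "measure M (space M)"], of 0])
  show "integrable M (\<lambda>x. \<Sum>n. f n x)"
    by (rule integrable_suminf[OF int ae sm])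
  show "(\<lambda>n. LINT x|M. f n x) sums (LINT x|M. (\<Sum>n. f n x))"
    by (rule sums_integral[OF int ae sm])
qed

lemma abs_cos_mode_le_1: "\<bar>cos_mode k x\<bar> \<le> 1"
  unfolding cos_mode_def abs_prod by (intro prod_le_1) auto

lemma infinite_UNIV_nat_vec: "infinite (UNIV :: (nat ^ 'n) set)"
proof -
  have "inj (\<lambda>n :: nat. \<chi> i :: 'n. n)"
    by (auto simp: inj_on_def vec_eq_iff)
  then show ?thesis
    using finite_subset[OF subset_UNIV] range_inj_infinite by blast
qed

lemma barron_enumeration:
  fixes u :: "real ^ 'n \<Rightarrow> real"
  assumes "u \<in> barron_space"
  obtains \<kappa> :: "nat \<Rightarrow> nat ^ 'n" where "bij \<kappa>"
    "(\<lambda>j. (1 + pi\<^sup>2 * (l1_norm (\<chi> i. real (\<kappa> j $ i)))\<^sup>2) * \<bar>cos_coeff u (\<kappa> j)\<bar>) sums barron_norm u"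
proof -
  define f where "f k = (1 + pi\<^sup>2 * (l1_norm (\<chi> i. real (k $ i)))\<^sup>2) * \<bar>cos_coeff u k\<bar>" for k
  have f0: "0 \<le> f k" for k by (simp add: f_def)
  obtain \<kappa> :: "nat \<Rightarrow> nat ^ 'n" where \<kappa>: "bij \<kappa>"
    using bij_betw_from_nat_into[OF _ infinite_UNIV_nat_vec] by auto
  have "barron_enorm u = (\<Sum>\<^sub>\<infinity>k\<in>UNIV. ennreal (f k))"
    by (simp add: barron_enorm_def f_def)
  also have "\<dots> = (\<Sum>\<^sub>\<infinity>j\<in>UNIV. ennreal (f (\<kappa> j)))"
    by (rule infsum_reindex_bij_betw[OF \<kappa>, symmetric])
  also have "\<dots> = (\<Sum>j. ennreal (f (\<kappa> j)))"
    by (rule sums_unique[OF has_sum_imp_sums[OF has_sum_infsum[OF nonneg_summable_on_complete]]]) simp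
  finally have e: "barron_enorm u = (\<Sum>j. ennreal (f (\<kappa> j)))" .
  have fin: "barron_enorm u \<noteq> \<infinity>"
    using assms by (auto simp: barron_space_def)
  have sm: "summable (\<lambda>j. f (\<kappa> j))"
    by (rule summable_suminf_not_top) (use fin e f0 in auto)
  have "barron_norm u = (\<Sum>j. f (\<kappa> j))"
    unfolding barron_norm_def e by (simp add: suminf_ennreal2 f0 sm suminf_nonneg)
  then have "(\<lambda>j. f (\<kappa> j)) sums barron_norm u"
    using summable_sums[OF sm] by simp
  then show ?thesis
    using that[OF \<kappa>] unfolding f_def by simp
qed

text \<open>
  The series converges uniformly and, by orthogonality, has the same coefficients as \<open>u\<close>; so the
  difference is orthogonal to all modes.
\<close>

lemma cosine_expansion:
  fixes u :: "real ^ 'n \<Rightarrow> real" and \<kappa> :: "nat \<Rightarrow> nat ^ 'n"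
  assumes int: "integrable (lebesgue_on unit_cube) u"
    and \<kappa>: "bij \<kappa>"
    and sm: "summable (\<lambda>j. \<bar>cos_coeff u (\<kappa> j)\<bar>)"
  shows "AE x in lebesgue_on unit_cube. u x = (\<Sum>j. cos_coeff u (\<kappa> j) * cos_mode (\<kappa> j) x)"
proof -
  let ?M = "lebesgue_on (unit_cube :: (real ^ 'n) set)"
  define a where "a j = cos_coeff u (\<kappa> j)" for j
  define U where "U x = (\<Sum>j. a j * cos_mode (\<kappa> j) x)" for x
  have mode: "cos_mode k \<in> borel_measurable ?M" for k :: "nat ^ 'n"
    using integrable_lebesgue_on_unit_cube[OF continuous_on_cos_mode] by (rule borel_measurable_integrable)
  have bd: "\<bar>a j * cos_mode k x\<bar> \<le> \<bar>a j\<bar>" for j k x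
    using mult_left_mono[OF abs_cos_mode_le_1, of "\<bar>a j\<bar>"] by (simp add: abs_mult)
  have bd2: "\<bar>a j * cos_mode k x * cos_mode l x\<bar> \<le> \<bar>a j\<bar>" for j k l x
    using mult_mono[OF bd abs_cos_mode_le_1, of j k x l x] by (simp add: abs_mult mult_ac)
  have smx: "summable (\<lambda>j. a j * cos_mode (\<kappa> j) x)" for x
    using sm unfolding a_def[symmetric]
    by (rule summable_comparison_test') (use bd in auto)
  have iU: "integrable ?M U"
    unfolding U_def
    by (rule integral_bounded_series(1)[OF finite_measure_unit_cube, where A = "\<lambda>j. \<bar>a j\<bar>"])
       (use bd sm mode in \<open>auto simp: a_def\<close>)
  have prod_int: "integrable ?M (\<lambda>x. f x * cos_mode k x)" if f: "integrable ?M f" for f k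
  proof (rule Bochner_Integration.integrable_bound[OF f])
    show "(\<lambda>x. f x * cos_mode k x) \<in> borel_measurable ?M"
      by (rule borel_measurable_times[OF borel_measurable_integrable[OF f] mode])
    show "AE x in ?M. norm (f x * cos_mode k x) \<le> norm (f x)"
      using mult_left_mono[OF abs_cos_mode_le_1, of "\<bar>f _\<bar>"] by (intro AE_I2) (simp add: abs_mult)
  qed
  have "AE x in ?M. u x - U x = 0"
  proof (rule cos_mode_orthogonal_imp_zero)
    show "integrable ?M (\<lambda>x. u x - U x)" using int iU by simp
    fix k :: "nat ^ 'n"
    obtain n where n: "k = \<kappa> n" using \<kappa> by (metis bij_pointE)
    have s1: "(\<lambda>j. LINT x|?M. a j * cos_mode (\<kappa> j) x * cos_mode k x) sums
        (LINT x|?M. (\<Sum>j. a j * cos_mode (\<kappa> j) x * cos_mode k x))"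
      by (rule integral_bounded_series(2)[OF finite_measure_unit_cube, where A = "\<lambda>j. \<bar>a j\<bar>"])
         (use bd2 sm mode in \<open>auto simp: a_def\<close>)
    have s2: "(\<Sum>j. a j * cos_mode (\<kappa> j) x * cos_mode k x) = U x * cos_mode k x" for x
      unfolding U_def by (rule suminf_mult2[OF smx, symmetric])
    have s3: "(\<lambda>j. LINT x|?M. a j * cos_mode (\<kappa> j) x * cos_mode k x) sums
        (LINT x|?M. a n * cos_mode (\<kappa> n) x * cos_mode k x)"
    proof -
      have "(LINT x|?M. a j * cos_mode (\<kappa> j) x * cos_mode k x) = 0" if "j \<noteq> n" for j
      proof -
        have "\<kappa> j \<noteq> k" using that \<kappa> n by (metis bij_is_inj injD)
        then show ?thesis using cos_mode_orthogonal[of "\<kappa> j" k] by (simp add: mult.assoc)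
      qed
      then have "(\<lambda>j. LINT x|?M. a j * cos_mode (\<kappa> j) x * cos_mode k x) =
          (\<lambda>j. if j = n then LINT x|?M. a j * cos_mode (\<kappa> j) x * cos_mode k x else 0)"
        by auto
      then show ?thesis
        using sums_single[of n "\<lambda>j. LINT x|?M. a j * cos_mode (\<kappa> j) x * cos_mode k x"] by (simp only:)
    qed
    have "(LINT x|?M. U x * cos_mode k x) = (LINT x|?M. a n * cos_mode (\<kappa> n) x * cos_mode k x)"
      using sums_unique2[OF s1 s3] unfolding s2 .
    also have "\<dots> = a n * (LINT x|?M. (cos_mode k x)\<^sup>2)"
      by (simp add: n power2_eq_square mult.assoc)
    also have "\<dots> = (LINT x|?M. u x * cos_mode k x)"
      using cos_mode_square_integral_pos[of k] by (simp add: a_def cos_coeff_def n)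
    finally show "(LINT x|?M. (u x - U x) * cos_mode k x) = 0"
      using prod_int[OF int, of k] prod_int[OF iU, of k] by (simp add: left_diff_distrib)
  qed
  then show ?thesis by eventually_elim (simp add: U_def a_def)
qed

section \<open>Bounded fields and atoms\<close>

text \<open>
  A neuron together with its gradient; the value \<open>0\<close> on the kink, a null set, is arbitrary.
\<close>

definition relu_atom :: "real ^ 'n \<Rightarrow> real \<Rightarrow> real ^ 'n \<Rightarrow> real \<times> (real ^ 'n)" where
  "relu_atom w t x = (ReLU (w \<bullet> x - t), if t < w \<bullet> x then w else 0)"

text \<open>
  The ridge function \<open>cos (l \<bullet> x) - 1\<close> together with its gradient.
\<close>

definition ridge_atom :: "real ^ 'n \<Rightarrow> real ^ 'n \<Rightarrow> real \<times> (real ^ 'n)" where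
  "ridge_atom l x = (cos (l \<bullet> x) - 1, - sin (l \<bullet> x) *\<^sub>R l)"

lemma l1_norm_nonneg: "0 \<le> l1_norm x"
  by (simp add: l1_norm_def sum_nonneg)

lemma norm_le_l1_norm: "norm x \<le> l1_norm x"
  unfolding l1_norm_def by (rule norm_le_l1_cart)

lemma l1_norm_scaleR: "l1_norm (c *\<^sub>R x) = \<bar>c\<bar> * l1_norm x"
  by (simp add: l1_norm_def abs_mult sum_distrib_left)

lemma l1_norm_minus: "l1_norm (- x) = l1_norm x"
  by (simp add: l1_norm_def)

lemma l1_norm_eq_0: "l1_norm x = 0 \<longleftrightarrow> x = 0"
  by (simp add: l1_norm_def sum_nonneg_eq_0_iff vec_eq_iff)

lemma abs_inner_unit_cube_le:
  assumes "x \<in> unit_cube"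
  shows "\<bar>w \<bullet> x\<bar> \<le> l1_norm w"
proof -
  have "\<bar>w \<bullet> x\<bar> \<le> (\<Sum>i\<in>UNIV. \<bar>w $ i * x $ i\<bar>)"
    unfolding inner_vec_def by (simp add: sum_abs)
  also have "\<dots> \<le> l1_norm w"
    unfolding l1_norm_def
    by (intro sum_mono) (use assms in \<open>auto simp: unit_cube_def mem_box_cart abs_mult intro!: mult_left_le\<close>)
  finally show ?thesis .
qed

lemma relu_atom_bound:
  assumes "l1_norm w = 1" "0 \<le> t" "x \<in> unit_cube"
  shows "norm (relu_atom w t x) \<le> 2"
proof -
  have "\<bar>ReLU (w \<bullet> x - t)\<bar> \<le> 1"
    using abs_inner_unit_cube_le[OF assms(3), of w] assms by (auto simp: ReLU_def)
  moreover have "norm (if t < w \<bullet> x then w else 0) \<le> 1"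
    using norm_le_l1_norm[of w] assms by auto
  ultimately show ?thesis
    unfolding relu_atom_def using norm_Pair_le[of "ReLU (w \<bullet> x - t)" "if t < w \<bullet> x then w else 0"]
    by (simp only: real_norm_def)
qed

lemma ridge_atom_bound: "norm (ridge_atom l x) \<le> 2 + l1_norm l"
proof -
  have "\<bar>cos (l \<bullet> x) - 1\<bar> \<le> 2"
    using cos_ge_minus_one[of "l \<bullet> x"] cos_le_one[of "l \<bullet> x"] by linarith
  moreover have "norm (- sin (l \<bullet> x) *\<^sub>R l) \<le> l1_norm l"
    using mult_right_mono[OF abs_sin_le_one[of "l \<bullet> x"] norm_ge_zero[of l]] norm_le_l1_norm[of l] by simp
  ultimately show ?thesis
    unfolding ridge_atom_def using norm_Pair_le[of "cos (l \<bullet> x) - 1" "- sin (l \<bullet> x) *\<^sub>R l"]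
    by (simp only: real_norm_def)
qed

text \<open>
  All functions that are paired below are bounded and live on a finite measure space, so this
  class settles every integrability question.
\<close>

definition bounded_measurable :: "'a measure \<Rightarrow> ('a \<Rightarrow> 'b::euclidean_space) \<Rightarrow> bool" where
  "bounded_measurable M f \<longleftrightarrow> f \<in> borel_measurable M \<and> (\<exists>C. \<forall>x\<in>space M. norm (f x) \<le> C)"

lemma bounded_measurableI:
  "f \<in> borel_measurable M \<Longrightarrow> (\<And>x. x \<in> space M \<Longrightarrow> norm (f x) \<le> C) \<Longrightarrow> bounded_measurable M f"
  by (auto simp: bounded_measurable_def)

lemma bounded_measurable_const: "bounded_measurable M (\<lambda>x. c)"
  by (rule bounded_measurableI[where C = "norm c"]) auto

lemma bounded_measurable_add:
  assumes "bounded_measurable M f" "bounded_measurable M g"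
  shows "bounded_measurable M (\<lambda>x. f x + g x)"
proof -
  obtain C D where "\<forall>x\<in>space M. norm (f x) \<le> C" "\<forall>x\<in>space M. norm (g x) \<le> D"
    using assms by (auto simp: bounded_measurable_def)
  then show ?thesis
    using assms by (intro bounded_measurableI[where C = "C + D"])
      (auto simp: bounded_measurable_def intro: norm_triangle_mono)
qed

lemma bounded_measurable_scaleR:
  assumes "bounded_measurable M f"
  shows "bounded_measurable M (\<lambda>x. c *\<^sub>R f x)"
proof -
  obtain C where "\<forall>x\<in>space M. norm (f x) \<le> C"
    using assms by (auto simp: bounded_measurable_def)
  then show ?thesis
    using assms by (intro bounded_measurableI[where C = "\<bar>c\<bar> * C"])
      (auto simp: bounded_measurable_def intro: mult_left_mono)
qed

lemma bounded_measurable_diff: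
  assumes "bounded_measurable M f" "bounded_measurable M g"
  shows "bounded_measurable M (\<lambda>x. f x - g x)"
  using bounded_measurable_add[OF assms(1) bounded_measurable_scaleR[OF assms(2), of "-1"]] by simp

lemma bounded_measurable_sum:
  "(\<And>i. i \<in> A \<Longrightarrow> bounded_measurable M (f i)) \<Longrightarrow> bounded_measurable M (\<lambda>x. \<Sum>i\<in>A. f i x)"
  by (induction A rule: infinite_finite_induct) (auto intro: bounded_measurable_add bounded_measurable_const)

lemma integrable_inner_bounded_measurable:
  assumes "finite_measure M" "bounded_measurable M f" "bounded_measurable M g"
  shows "integrable M (\<lambda>x. f x \<bullet> g x)"
proof -
  interpret finite_measure M by fact
  obtain C D where CD: "\<forall>x\<in>space M. norm (f x) \<le> C" "\<forall>x\<in>space M. norm (g x) \<le> D"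
    using assms by (auto simp: bounded_measurable_def)
  show ?thesis
  proof (rule integrable_const_bound[of _ "C * D"])
    show "AE x in M. norm (f x \<bullet> g x) \<le> C * D"
    proof (rule AE_I2)
      fix x assume x: "x \<in> space M"
      have "norm (f x \<bullet> g x) \<le> norm (f x) * norm (g x)" by (simp add: Cauchy_Schwarz_ineq2)
      also have "\<dots> \<le> C * D"
        using CD x order_trans[OF norm_ge_zero[of "f x"]] by (intro mult_mono) auto
      finally show "norm (f x \<bullet> g x) \<le> C * D" .
    qed
  qed (use assms in \<open>auto simp: bounded_measurable_def\<close>)
qed

lemma borel_measurable_id_lebesgue_on:
  "(\<lambda>x :: 'a::euclidean_space. x) \<in> borel_measurable (lebesgue_on S)"
  by (intro measurable_restrict_space1 measurable_completion) simp

lemma relu_atom_measurable: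
  "(\<lambda>p. relu_atom w (snd p) (fst p)) \<in> borel_measurable (lebesgue_on S \<Otimes>\<^sub>M lebesgue_on T)"
proof -
  note [measurable] = borel_measurable_id_lebesgue_on[of S] borel_measurable_id_lebesgue_on[of T]
  have [measurable]: "fst \<in> borel_measurable (lebesgue_on S \<Otimes>\<^sub>M lebesgue_on T)"
    "snd \<in> borel_measurable (lebesgue_on S \<Otimes>\<^sub>M lebesgue_on T)"
    using measurable_compose[OF measurable_fst borel_measurable_id_lebesgue_on[of S]]
      measurable_compose[OF measurable_snd borel_measurable_id_lebesgue_on[of T]] by auto
  show ?thesis
    unfolding relu_atom_def ReLU_def by measurable
qed

lemma relu_atom_bounded_measurable:
  assumes "l1_norm w = 1" "0 \<le> t"
  shows "bounded_measurable (lebesgue_on unit_cube) (relu_atom w t)"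
proof (rule bounded_measurableI[where C = 2])
  note [measurable] = borel_measurable_id_lebesgue_on[of unit_cube]
  show "relu_atom w t \<in> borel_measurable (lebesgue_on unit_cube)"
    unfolding relu_atom_def ReLU_def by measurable
qed (use relu_atom_bound[OF assms] in auto)

lemma ridge_atom_bounded_measurable:
  "bounded_measurable (lebesgue_on unit_cube) (ridge_atom l)"
proof (rule bounded_measurableI[where C = "2 + l1_norm l"])
  note [measurable] = borel_measurable_id_lebesgue_on[of unit_cube]
  show "ridge_atom l \<in> borel_measurable (lebesgue_on unit_cube)"
    unfolding ridge_atom_def by measurable
qed (rule ridge_atom_bound)

section \<open>Ridge cosines as mixtures of neurons\<close>

text \<open>
  Taylor's formula at \<open>0\<close> for \<open>cos (\<rho> z)\<close>, and its derivative in \<open>z\<close>.  Both signs of \<open>z\<close> are covered at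
  once: for \<open>t \<ge> 0\<close> only one of the two hinges is active, and the formulas are even and odd in \<open>z\<close>,
  respectively.
\<close>

lemma integral_cos_times_hinge:
  fixes z \<rho> :: real
  assumes "\<bar>z\<bar> \<le> 1" "\<rho> \<noteq> 0"
  shows "((\<lambda>t. cos (\<rho> * t) * (ReLU (z - t) + ReLU (- z - t))) has_integral (1 - cos (\<rho> * z)) / \<rho>\<^sup>2) {0..1}"
    and "((\<lambda>t. cos (\<rho> * t) * ((if t < z then 1 else 0) - (if t < - z then 1 else 0)))
           has_integral sin (\<rho> * z) / \<rho>) {0..1}"
proof -
  have A: "((\<lambda>t. cos (\<rho> * t) * (ReLU (z - t) + ReLU (- z - t))) has_integral (1 - cos (\<rho> * z)) / \<rho>\<^sup>2) {0..1}"
    if z: "0 \<le> z" "z \<le> 1" for z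
  proof -
    have "((\<lambda>t. cos (\<rho> * t) * (z - t)) has_integral
       ((z - z) * sin (\<rho> * z) / \<rho> - cos (\<rho> * z) / \<rho>\<^sup>2) - ((z - 0) * sin (\<rho> * 0) / \<rho> - cos (\<rho> * 0) / \<rho>\<^sup>2)) {0..z}"
      using z(1) assms(2)
      by (intro fundamental_theorem_of_calculus)
         (auto intro!: derivative_eq_intros
            simp: has_real_derivative_iff_has_vector_derivative[symmetric] field_simps power2_eq_square)
    then have "((\<lambda>t. cos (\<rho> * t) * (z - t)) has_integral (1 - cos (\<rho> * z)) / \<rho>\<^sup>2) {0..z}"
      by (simp add: diff_divide_distrib)
    then have 1: "((\<lambda>t. cos (\<rho> * t) * (ReLU (z - t) + ReLU (- z - t))) has_integral (1 - cos (\<rho> * z)) / \<rho>\<^sup>2) {0..z}"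
      by (rule has_integral_eq[rotated]) (use z in \<open>auto simp: ReLU_def\<close>)
    have 2: "((\<lambda>t. cos (\<rho> * t) * (ReLU (z - t) + ReLU (- z - t))) has_integral 0) {z..1}"
      by (rule has_integral_eq[OF _ has_integral_0]) (use z in \<open>auto simp: ReLU_def\<close>)
    show ?thesis
      using has_integral_combine[OF z 1 2] by simp
  qed
  have B: "((\<lambda>t. cos (\<rho> * t) * ((if t < z then 1 else 0) - (if t < - z then 1 else 0)))
           has_integral sin (\<rho> * z) / \<rho>) {0..1}"
    if z: "0 \<le> z" "z \<le> 1" for z
  proof -
    have "((\<lambda>t. cos (\<rho> * t)) has_integral sin (\<rho> * z) / \<rho> - sin (\<rho> * 0) / \<rho>) {0..z}"
      using z(1) assms(2)
      by (intro fundamental_theorem_of_calculus)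
         (auto intro!: derivative_eq_intros simp: has_real_derivative_iff_has_vector_derivative[symmetric])
    then have "((\<lambda>t. cos (\<rho> * t)) has_integral sin (\<rho> * z) / \<rho>) {0..z}" by simp
    then have 1: "((\<lambda>t. cos (\<rho> * t) * ((if t < z then 1 else 0) - (if t < - z then 1 else 0)))
        has_integral sin (\<rho> * z) / \<rho>) {0..z}"
      by (rule has_integral_spike_finite[where S = "{z}", rotated 2]) (use z in auto)
    have 2: "((\<lambda>t. cos (\<rho> * t) * ((if t < z then 1 else 0) - (if t < - z then 1 else 0))) has_integral 0) {z..1}"
      by (rule has_integral_eq[OF _ has_integral_0]) (use z in auto)
    show ?thesis
      using has_integral_combine[OF z 1 2] by simp
  qed
  show "((\<lambda>t. cos (\<rho> * t) * (ReLU (z - t) + ReLU (- z - t))) has_integral (1 - cos (\<rho> * z)) / \<rho>\<^sup>2) {0..1}"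
    using A[of z] A[of "- z"] assms(1) by (cases "0 \<le> z") (auto simp: add.commute)
  show "((\<lambda>t. cos (\<rho> * t) * ((if t < z then 1 else 0) - (if t < - z then 1 else 0)))
           has_integral sin (\<rho> * z) / \<rho>) {0..1}"
  proof (cases "0 \<le> z")
    case True
    then show ?thesis using B[of z] assms(1) by auto
  next
    case False
    then have "((\<lambda>t. - (cos (\<rho> * t) * ((if t < - z then 1 else 0) - (if t < - (- z) then 1 else 0))))
           has_integral - (sin (\<rho> * - z) / \<rho>)) {0..1}"
      using assms(1) by (intro has_integral_neg B) auto
    then show ?thesis by (simp add: algebra_simps)
  qed
qed

text \<open>
  The representation is stated after pairing with a fixed vector \<open>r\<close>, which covers value and gradient
  by a single real integral.
\<close>

lemma ridge_atom_as_relu_integral: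
  fixes w :: "real ^ 'n" and r :: "real \<times> (real ^ 'n)"
  assumes w: "l1_norm w = 1" and x: "x \<in> unit_cube" and \<rho>: "\<rho> \<noteq> 0"
  shows "((\<lambda>t. cos (\<rho> * t) * (r \<bullet> relu_atom w t x + r \<bullet> relu_atom (- w) t x))
     has_integral - (r \<bullet> ridge_atom (\<rho> *\<^sub>R w) x) / \<rho>\<^sup>2) {0..1}"
proof -
  obtain a b where r: "r = (a, b)" by (cases r)
  let ?z = "w \<bullet> x"
  have z: "\<bar>?z\<bar> \<le> 1" using abs_inner_unit_cube_le[OF x, of w] w by simp
  have "((\<lambda>t. a * (cos (\<rho> * t) * (ReLU (?z - t) + ReLU (- ?z - t))) +
      (b \<bullet> w) * (cos (\<rho> * t) * ((if t < ?z then 1 else 0) - (if t < - ?z then 1 else 0))))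
     has_integral a * ((1 - cos (\<rho> * ?z)) / \<rho>\<^sup>2) + (b \<bullet> w) * (sin (\<rho> * ?z) / \<rho>)) {0..1}"
    by (intro has_integral_add has_integral_mult_right integral_cos_times_hinge z \<rho>)
  moreover have "a * ((1 - cos (\<rho> * ?z)) / \<rho>\<^sup>2) + (b \<bullet> w) * (sin (\<rho> * ?z) / \<rho>)
      = - (r \<bullet> ridge_atom (\<rho> *\<^sub>R w) x) / \<rho>\<^sup>2"
    using \<rho> by (simp add: r ridge_atom_def field_simps power2_eq_square)
  moreover have "a * (cos (\<rho> * t) * (ReLU (?z - t) + ReLU (- ?z - t))) +
      (b \<bullet> w) * (cos (\<rho> * t) * ((if t < ?z then 1 else 0) - (if t < - ?z then 1 else 0)))
     = cos (\<rho> * t) * (r \<bullet> relu_atom w t x + r \<bullet> relu_atom (- w) t x)" for t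
    by (simp add: r relu_atom_def algebra_simps)
  ultimately show ?thesis by simp
qed

text \<open>
  Fubini exchanges the integral over the cube with the one over thresholds; for each threshold the two
  neurons, in directions \<open>w\<close> and \<open>- w\<close>, contribute at most \<open>s\<close> each.
\<close>

lemma ridge_pairing_bound:
  fixes R :: "real ^ 'n \<Rightarrow> real \<times> (real ^ 'n)"
  assumes R: "bounded_measurable (lebesgue_on unit_cube) R"
    and s: "\<And>w t. l1_norm w = 1 \<Longrightarrow> 0 \<le> t \<Longrightarrow> t \<le> 1 \<Longrightarrow>
       \<bar>LINT x|lebesgue_on unit_cube. R x \<bullet> relu_atom w t x\<bar> \<le> s"
  shows "\<bar>LINT x|lebesgue_on unit_cube. R x \<bullet> ridge_atom l x\<bar> \<le> 2 * (l1_norm l)\<^sup>2 * s"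
proof (cases "l = 0")
  case True
  then show ?thesis by (simp add: ridge_atom_def l1_norm_def zero_prod_def[symmetric])
next
  case False
  let ?M = "lebesgue_on (unit_cube :: (real ^ 'n) set)"
  let ?T = "lebesgue_on {0..1 :: real}"
  interpret M: finite_measure ?M by (rule finite_measure_unit_cube)
  interpret T: finite_measure ?T by (rule finite_measure_lebesgue_on) simp
  interpret pair_sigma_finite ?M ?T ..
  interpret MT: finite_measure "?M \<Otimes>\<^sub>M ?T"
    by (rule finite_measure_pair_measure) unfold_locales
  define \<rho> where "\<rho> = l1_norm l"
  have \<rho>: "\<rho> > 0" using False l1_norm_nonneg[of l] by (simp add: \<rho>_def l1_norm_eq_0 less_le)
  define w where "w = (1 / \<rho>) *\<^sub>R l"
  have l: "l = \<rho> *\<^sub>R w" using \<rho> by (simp add: w_def)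
  have w: "l1_norm w = 1" "l1_norm (- w) = 1"
    using \<rho> by (simp_all add: w_def l1_norm_scaleR l1_norm_minus \<rho>_def)
  define K where "K x t = cos (\<rho> * t) * (R x \<bullet> relu_atom w t x + R x \<bullet> relu_atom (- w) t x)" for x t
  obtain C where C: "\<And>x. x \<in> unit_cube \<Longrightarrow> norm (R x) \<le> C"
    and Rm: "R \<in> borel_measurable ?M"
    using R by (auto simp: bounded_measurable_def)
  have "0 \<in> (unit_cube :: (real ^ 'n) set)" by (simp add: unit_cube_def mem_box_cart)
  then have C0: "0 \<le> C" by (rule order_trans[OF norm_ge_zero C])
  have inn: "\<bar>R x \<bullet> relu_atom v t x\<bar> \<le> C * 2" if "x \<in> unit_cube" "0 \<le> t" "l1_norm v = 1" for x t v
    by (rule order_trans[OF Cauchy_Schwarz_ineq2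
          mult_mono[OF C[OF that(1)] relu_atom_bound[OF that(3,2,1)] C0 norm_ge_zero]])
  have Kb: "\<bar>K x t\<bar> \<le> C * 4" if "x \<in> unit_cube" "0 \<le> t" for x t
  proof -
    have "\<bar>K x t\<bar> \<le> 1 * \<bar>R x \<bullet> relu_atom w t x + R x \<bullet> relu_atom (- w) t x\<bar>"
      unfolding K_def abs_mult by (intro mult_right_mono) auto
    also have "\<dots> \<le> C * 4"
      using abs_triangle_ineq[of "R x \<bullet> relu_atom w t x" "R x \<bullet> relu_atom (- w) t x"]
        inn[OF that w(1)] inn[OF that w(2)] by simp
    finally show ?thesis .
  qed
  have Rf: "(\<lambda>p. R (fst p)) \<in> borel_measurable (?M \<Otimes>\<^sub>M ?T)"
    by (rule measurable_compose[OF measurable_fst Rm])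
  have tm: "(\<lambda>p. snd p) \<in> borel_measurable (?M \<Otimes>\<^sub>M ?T)"
    by (rule measurable_compose[OF measurable_snd borel_measurable_id_lebesgue_on])
  have Km: "(\<lambda>(x, t). K x t) \<in> borel_measurable (?M \<Otimes>\<^sub>M ?T)"
    unfolding K_def case_prod_beta
    by (intro borel_measurable_times borel_measurable_add borel_measurable_inner Rf relu_atom_measurable
        measurable_compose[OF borel_measurable_times[OF borel_measurable_const tm]
          borel_measurable_continuous_onI[OF continuous_on_cos[OF continuous_on_id]]])
  have Ki: "integrable (?M \<Otimes>\<^sub>M ?T) (\<lambda>(x, t). K x t)"
    by (rule MT.integrable_const_bound[OF _ Km, of "C * 4"])
       (auto intro!: AE_I2 Kb simp: space_pair_measure)
  have inner_int: "(LINT t|?T. K x t) = - (R x \<bullet> ridge_atom l x) / \<rho>\<^sup>2" if x: "x \<in> unit_cube" for x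
  proof -
    have "integrable ?T (K x)"
    proof (rule T.integrable_const_bound[of _ "C * 4"])
      show "K x \<in> borel_measurable ?T"
        using measurable_compose[OF measurable_Pair1'[of x ?M ?T] Km] x by simp
    qed (use x Kb in \<open>auto intro!: AE_I2\<close>)
    then have "(LINT t|?T. K x t) = integral {0..1} (K x)"
      by (rule lebesgue_integral_eq_integral) simp
    also have "\<dots> = - (R x \<bullet> ridge_atom l x) / \<rho>\<^sup>2"
      unfolding K_def l by (rule integral_unique[OF ridge_atom_as_relu_integral]) (use w x \<rho> in auto)
    finally show ?thesis .
  qed
  have outer: "\<bar>LINT x|?M. K x t\<bar> \<le> 2 * s" if t: "t \<in> {0..1}" for t
  proof -
    have i: "integrable ?M (\<lambda>x. R x \<bullet> relu_atom v t x)" if "l1_norm v = 1" for v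
      using t that by (intro integrable_inner_bounded_measurable finite_measure_unit_cube R relu_atom_bounded_measurable) auto
    have "(LINT x|?M. K x t) =
        cos (\<rho> * t) * ((LINT x|?M. R x \<bullet> relu_atom w t x) + (LINT x|?M. R x \<bullet> relu_atom (- w) t x))"
      unfolding K_def using i[OF w(1)] i[OF w(2)] by simp
    also have "\<bar>\<dots>\<bar> \<le> 1 * \<bar>(LINT x|?M. R x \<bullet> relu_atom w t x) + (LINT x|?M. R x \<bullet> relu_atom (- w) t x)\<bar>"
      unfolding abs_mult by (intro mult_right_mono) auto
    also have "\<dots> \<le> 2 * s"
      using s[OF w(1), of t] s[OF w(2), of t] t by auto
    finally show ?thesis .
  qed
  have "(LINT x|?M. R x \<bullet> ridge_atom l x) = (LINT x|?M. - \<rho>\<^sup>2 * (LINT t|?T. K x t))"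
    using \<rho> by (intro Bochner_Integration.integral_cong) (auto simp: inner_int)
  also have "\<dots> = - \<rho>\<^sup>2 * (LINT t|?T. (LINT x|?M. K x t))"
    using Fubini_integral[OF Ki] by simp
  also have "\<bar>\<dots>\<bar> = \<rho>\<^sup>2 * \<bar>LINT t|?T. (LINT x|?M. K x t)\<bar>"
    by (simp add: abs_mult)
  also have "\<bar>LINT t|?T. (LINT x|?M. K x t)\<bar> \<le> (LINT t|?T. \<bar>LINT x|?M. K x t\<bar>)"
    by (rule integral_abs_bound)
  also have "\<dots> \<le> (LINT t|?T. 2 * s)"
    by (intro integral_mono integrable_abs integrable_snd Ki) (use outer in auto)
  also have "\<dots> = 2 * s"
    by (simp add: measure_restrict_space)
  finally show ?thesis
    using \<rho> by (simp add: \<rho>_def mult_left_mono algebra_simps)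
qed

section \<open>The greedy form of Maurey's lemma\<close>

text \<open>
  Adding \<open>h\<close> changes the residual \<open>R = m F - \<Sum> g\<^sub>i\<close> to \<open>R + (F - h)\<close>, whose square is
  \<open>|R|\<^sup>2 + 2 R \<bullet> (F - h) + |F - h|\<^sup>2\<close>.  The choice of \<open>h\<close> makes the integral of the cross term nonpositive.
  In Maurey's lemma the cross term vanishes in the mean over a random \<open>h\<close>.
\<close>

lemma greedy_approximation:
  fixes F :: "'a \<Rightarrow> 'b::euclidean_space"
  assumes M: "finite_measure M" and F: "bounded_measurable M F"
    and D: "\<And>g. g \<in> D \<Longrightarrow> bounded_measurable M g"
    and step: "\<And>R. bounded_measurable M R \<Longrightarrow> \<exists>g\<in>D. (LINT x|M. R x \<bullet> F x) \<le> (LINT x|M. R x \<bullet> g x)"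
    and K: "\<And>g. g \<in> D \<Longrightarrow> (LINT x|M. (norm (F x - g x))\<^sup>2) \<le> K"
  shows "\<exists>g. (\<forall>i\<in>{1..m}. g i \<in> D) \<and>
     (LINT x|M. (norm (real m *\<^sub>R F x - (\<Sum>i=1..m. g i x)))\<^sup>2) \<le> real m * K"
proof (induction m)
  case 0
  then show ?case by simp
next
  case (Suc m)
  then obtain g where g: "\<forall>i\<in>{1..m}. g i \<in> D"
    and le: "(LINT x|M. (norm (real m *\<^sub>R F x - (\<Sum>i=1..m. g i x)))\<^sup>2) \<le> real m * K" by blast
  define R where "R x = real m *\<^sub>R F x - (\<Sum>i=1..m. g i x)" for x
  have R: "bounded_measurable M R"
    unfolding R_def using g
    by (intro bounded_measurable_diff bounded_measurable_scaleR bounded_measurable_sum F D) auto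
  obtain h where h: "h \<in> D" "(LINT x|M. R x \<bullet> F x) \<le> (LINT x|M. R x \<bullet> h x)"
    using step[OF R] by blast
  have hb: "bounded_measurable M h" by (rule D[OF h(1)])
  have Fh: "bounded_measurable M (\<lambda>x. F x - h x)" by (rule bounded_measurable_diff[OF F hb])
  note int = integrable_inner_bounded_measurable[OF M]
  define g' where "g' = g(Suc m := h)"
  have "(\<Sum>i=1..Suc m. g' i x) = (\<Sum>i=1..m. g i x) + h x" for x
    by (simp add: g'_def)
  then have E: "real (Suc m) *\<^sub>R F x - (\<Sum>i=1..Suc m. g' i x) = R x + (F x - h x)" for x
    by (simp add: R_def algebra_simps)
  have sq: "(norm (r + d))\<^sup>2 = r \<bullet> r + 2 * (r \<bullet> d) + d \<bullet> d" for r d :: 'b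
    by (simp add: power2_norm_eq_inner inner_add_left inner_add_right inner_commute)
  have "(LINT x|M. (norm (real (Suc m) *\<^sub>R F x - (\<Sum>i=1..Suc m. g' i x)))\<^sup>2)
     = (LINT x|M. R x \<bullet> R x + 2 * (R x \<bullet> F x - R x \<bullet> h x) + (F x - h x) \<bullet> (F x - h x))"
    unfolding E sq inner_diff_right[of "R _"] ..
  also have "\<dots> = (LINT x|M. R x \<bullet> R x) + 2 * ((LINT x|M. R x \<bullet> F x) - (LINT x|M. R x \<bullet> h x))
      + (LINT x|M. (F x - h x) \<bullet> (F x - h x))"
    using int[OF R R] int[OF R F] int[OF R hb] int[OF Fh Fh] by simp
  also have "\<dots> \<le> real m * K + 2 * 0 + K"
    using le h K[OF h(1)] by (intro add_mono mult_left_mono) (simp_all add: R_def power2_norm_eq_inner)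
  finally have "(LINT x|M. (norm (real (Suc m) *\<^sub>R F x - (\<Sum>i=1..Suc m. g' i x)))\<^sup>2) \<le> real (Suc m) * K"
    by (simp add: algebra_simps)
  moreover have "\<forall>i\<in>{1..Suc m}. g' i \<in> D"
    using g h(1) by (auto simp: g'_def le_Suc_eq)
  ultimately show ?case by blast
qed

section \<open>Pairing with the atom of a Barron function\<close>

text \<open>
  Induction with \<open>cos (\<alpha> + \<beta>) + cos (- \<alpha> + \<beta>) = 2 cos \<alpha> cos \<beta>\<close>; a set \<open>S\<close> records the coordinates whose
  sign is flipped.
\<close>

lemma prod_cos_eq_sign_average:
  fixes \<theta> :: "'i \<Rightarrow> real"
  assumes "finite A"
  shows "(\<Prod>i\<in>A. cos (\<theta> i)) =
    (\<Sum>S\<in>Pow A. cos (\<Sum>i\<in>A. (if i \<in> S then - \<theta> i else \<theta> i))) / 2 ^ card A"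
  using assms
proof (induction A rule: finite_induct)
  case empty
  then show ?case by simp
next
  case (insert a A)
  let ?X = "\<lambda>S. \<Sum>i\<in>A. (if i \<in> S then - \<theta> i else \<theta> i)"
  let ?Y = "\<lambda>S. cos (\<Sum>i\<in>insert a A. (if i \<in> S then - \<theta> i else \<theta> i))"
  have Y1: "?Y S = cos (\<theta> a + ?X S)" if "S \<in> Pow A" for S
    using that insert.hyps by (subst sum.insert) auto
  have Y2: "?Y (insert a S) = cos (- \<theta> a + ?X S)" if "S \<in> Pow A" for S
  proof -
    have "(\<Sum>i\<in>A. (if i \<in> insert a S then - \<theta> i else \<theta> i)) = ?X S"
      using insert.hyps by (intro sum.cong) auto
    then show ?thesis using insert.hyps by (subst sum.insert) auto
  qed
  have inj: "inj_on (insert a) (Pow A)"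
    using insert.hyps by (auto simp: inj_on_def)
  have "(\<Sum>S\<in>Pow (insert a A). ?Y S) = (\<Sum>S\<in>Pow A. ?Y S) + (\<Sum>S\<in>insert a ` Pow A. ?Y S)"
    unfolding Pow_insert using insert.hyps by (intro sum.union_disjoint) auto
  also have "\<dots> = (\<Sum>S\<in>Pow A. cos (\<theta> a + ?X S)) + (\<Sum>S\<in>Pow A. cos (- \<theta> a + ?X S))"
    using Y1 Y2 by (simp add: sum.reindex[OF inj])
  also have "\<dots> = 2 * cos (\<theta> a) * (\<Sum>S\<in>Pow A. cos (?X S))"
    unfolding sum.distrib[symmetric] sum_distrib_left by (intro sum.cong) (auto simp: cos_add cos_diff)
  finally show ?case
    using insert by simp
qed

definition signed_freq :: "'n set \<Rightarrow> nat ^ 'n \<Rightarrow> real ^ 'n" where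
  "signed_freq S k = (\<chi> i. (if i \<in> S then - 1 else 1) * (pi * real (k $ i)))"

definition freq_norm :: "nat ^ 'n \<Rightarrow> real" where
  "freq_norm k = l1_norm (\<chi> i. real (k $ i))"

text \<open>
  The cosine mode minus \<open>1\<close>, together with its gradient, written as a mean of ridge atoms so that the
  estimates for those carry over by the triangle inequality.
\<close>

definition mode_atom :: "nat ^ 'n \<Rightarrow> real ^ 'n \<Rightarrow> real \<times> (real ^ 'n)" where
  "mode_atom k x = (1 / 2 ^ CARD('n)) *\<^sub>R (\<Sum>S\<in>UNIV. ridge_atom (signed_freq S k) x)"

lemma l1_norm_signed_freq: "l1_norm (signed_freq S k) = pi * freq_norm k"
  by (auto simp: l1_norm_def signed_freq_def freq_norm_def abs_mult sum_distrib_left intro!: sum.cong)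

lemma card_UNIV_set: "real (card (UNIV :: 'n::finite set set)) = 2 ^ CARD('n)"
  using card_Pow[of "UNIV :: 'n set"] by simp

lemma fst_mode_atom: "fst (mode_atom k x) = cos_mode k x - 1"
  for k :: "nat ^ 'n"
proof -
  have "(signed_freq S k \<bullet> x) = (\<Sum>i\<in>UNIV. (if i \<in> S then - (pi * real (k $ i) * x $ i) else pi * real (k $ i) * x $ i))" for S
    by (auto simp: inner_vec_def signed_freq_def intro!: sum.cong)
  then have "cos_mode k x = (\<Sum>S\<in>UNIV. cos (signed_freq S k \<bullet> x)) / 2 ^ CARD('n)"
    unfolding cos_mode_def by (subst prod_cos_eq_sign_average) simp_all
  then show ?thesis
    by (simp add: mode_atom_def ridge_atom_def fst_sum sum_subtractf card_UNIV_set[unfolded of_nat_eq_iff] field_simps card_UNIV_set)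
qed

lemma mode_atom_bound: "norm (mode_atom k x) \<le> 2 + pi * freq_norm k"
  for k :: "nat ^ 'n"
proof -
  have "norm (\<Sum>S\<in>(UNIV :: 'n set set). ridge_atom (signed_freq S k) x) \<le> (\<Sum>S\<in>(UNIV :: 'n set set). 2 + pi * freq_norm k)"
    by (rule sum_norm_le) (use ridge_atom_bound[of "signed_freq _ k" x] in \<open>simp add: l1_norm_signed_freq\<close>)
  also have "\<dots> = 2 ^ CARD('n) * (2 + pi * freq_norm k)"
    by (simp only: sum_constant card_UNIV_set)
  finally show ?thesis
    by (simp add: mode_atom_def field_simps)
qed

lemma mode_atom_bounded_measurable: "bounded_measurable (lebesgue_on unit_cube) (mode_atom k)"
  unfolding mode_atom_def[abs_def]
  by (intro bounded_measurable_scaleR bounded_measurable_sum ridge_atom_bounded_measurable)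

lemma mode_pairing_bound:
  fixes R :: "real ^ 'n \<Rightarrow> real \<times> (real ^ 'n)"
  assumes R: "bounded_measurable (lebesgue_on unit_cube) R"
    and s: "\<And>w t. l1_norm w = 1 \<Longrightarrow> 0 \<le> t \<Longrightarrow> t \<le> 1 \<Longrightarrow>
       \<bar>LINT x|lebesgue_on unit_cube. R x \<bullet> relu_atom w t x\<bar> \<le> s"
  shows "\<bar>LINT x|lebesgue_on unit_cube. R x \<bullet> mode_atom k x\<bar> \<le> 2 * (pi * freq_norm k)\<^sup>2 * s"
proof -
  let ?M = "lebesgue_on (unit_cube :: (real ^ 'n) set)"
  have i: "integrable ?M (\<lambda>x. R x \<bullet> ridge_atom l x)" for l
    by (intro integrable_inner_bounded_measurable finite_measure_unit_cube R ridge_atom_bounded_measurable)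
  have "(LINT x|?M. R x \<bullet> mode_atom k x) = (\<Sum>S\<in>UNIV. LINT x|?M. R x \<bullet> ridge_atom (signed_freq S k) x) / 2 ^ CARD('n)"
    using i by (simp add: mode_atom_def inner_sum_right)
  also have "\<bar>\<dots>\<bar> = \<bar>\<Sum>S\<in>UNIV. LINT x|?M. R x \<bullet> ridge_atom (signed_freq S k) x\<bar> / 2 ^ CARD('n)"
    by simp
  also have "\<dots> \<le> (\<Sum>S\<in>(UNIV :: 'n set set). 2 * (pi * freq_norm k)\<^sup>2 * s) / 2 ^ CARD('n)"
  proof (rule divide_right_mono[OF order_trans[OF sum_abs sum_mono]])
    show "\<bar>LINT x|?M. R x \<bullet> ridge_atom (signed_freq S k) x\<bar> \<le> 2 * (pi * freq_norm k)\<^sup>2 * s" for S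
      using ridge_pairing_bound[OF R s, of "signed_freq S k"] by (simp only: l1_norm_signed_freq)
  qed simp
  also have "\<dots> = 2 * (pi * freq_norm k)\<^sup>2 * s"
    by (simp only: sum_constant card_UNIV_set) simp
  finally show ?thesis .
qed

text \<open>
  With \<open>p = pi |k|\<^sub>1\<close>, the size \<open>2 + p\<close> of a mode atom and the mass \<open>2 p\<^sup>2\<close> of its neurons are both
  controlled by the Barron weight \<open>1 + p\<^sup>2\<close>, which is why every bound for \<open>F\<close> is a multiple of \<open>B\<close>.
\<close>

lemma barron_series:
  fixes \<kappa> :: "nat \<Rightarrow> nat ^ 'n" and a :: "nat \<Rightarrow> real"
  assumes sums: "(\<lambda>j. (1 + pi\<^sup>2 * (freq_norm (\<kappa> j))\<^sup>2) * \<bar>a j\<bar>) sums B"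
  defines "F \<equiv> \<lambda>x. \<Sum>j. a j *\<^sub>R mode_atom (\<kappa> j) x"
  shows barron_series_summable: "summable (\<lambda>j. a j *\<^sub>R mode_atom (\<kappa> j) x)"
    and barron_series_bound: "norm (F x) \<le> 5 / 2 * B"
    and barron_series_bounded_measurable: "bounded_measurable (lebesgue_on unit_cube) F"
    and barron_series_pairing: "\<And>R s. bounded_measurable (lebesgue_on unit_cube) R \<Longrightarrow>
       (\<And>w t. l1_norm w = 1 \<Longrightarrow> 0 \<le> t \<Longrightarrow> t \<le> 1 \<Longrightarrow>
         \<bar>LINT x|lebesgue_on unit_cube. R x \<bullet> relu_atom w t x\<bar> \<le> s) \<Longrightarrow>
       \<bar>LINT x|lebesgue_on unit_cube. R x \<bullet> F x\<bar> \<le> 2 * B * s"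
proof -
  let ?M = "lebesgue_on (unit_cube :: (real ^ 'n) set)"
  let ?b = "\<lambda>j. (1 + pi\<^sup>2 * (freq_norm (\<kappa> j))\<^sup>2) * \<bar>a j\<bar>"
  have bd: "norm (a j *\<^sub>R mode_atom (\<kappa> j) x) \<le> 5 / 2 * ?b j" for j x
  proof -
    define p where "p = pi * freq_norm (\<kappa> j)"
    \<comment> \<open>\<open>1/5\<close> is the minimiser of \<open>5/2 (1 + p\<^sup>2) - (2 + p)\<close>, whose minimum is still positive.\<close>
    have "0 \<le> (p - 1 / 5)\<^sup>2" by simp
    then have p: "2 + p \<le> 5 / 2 * (1 + p\<^sup>2)"
      by (simp add: power2_eq_square algebra_simps)
    have "norm (a j *\<^sub>R mode_atom (\<kappa> j) x) \<le> \<bar>a j\<bar> * (2 + p)"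
      using mode_atom_bound[of "\<kappa> j" x] by (simp add: p_def mult_left_mono)
    also have "\<dots> \<le> \<bar>a j\<bar> * (5 / 2 * (1 + p\<^sup>2))"
      by (intro mult_left_mono p) simp
    finally show ?thesis by (simp add: p_def power_mult_distrib mult_ac)
  qed
  have smb: "summable (\<lambda>j. 5 / 2 * ?b j)" "(\<Sum>j. 5 / 2 * ?b j) = 5 / 2 * B"
    using sums_mult[OF sums, of "5 / 2"] by (simp_all add: sums_iff)
  have smn: "summable (\<lambda>j. norm (a j *\<^sub>R mode_atom (\<kappa> j) x))" for x
    by (rule summable_comparison_test'[OF smb(1), of 0]) (use bd in simp)
  then show sm: "summable (\<lambda>j. a j *\<^sub>R mode_atom (\<kappa> j) x)" for x
    by (rule summable_norm_cancel)
  have "norm (F x) \<le> (\<Sum>j. norm (a j *\<^sub>R mode_atom (\<kappa> j) x))" for x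
    unfolding F_def by (rule summable_norm[OF smn])
  also have "\<dots> x \<le> (\<Sum>j. 5 / 2 * ?b j)" for x
    by (rule suminf_le[OF bd smn smb(1)])
  finally show Fb: "norm (F x) \<le> 5 / 2 * B" for x unfolding smb(2) .
  have am: "(\<lambda>x. a j *\<^sub>R mode_atom (\<kappa> j) x) \<in> borel_measurable ?M" for j
    using bounded_measurable_scaleR[OF mode_atom_bounded_measurable] by (auto simp: bounded_measurable_def)
  have "integrable ?M F"
    unfolding F_def by (rule integral_bounded_series(1)[OF finite_measure_unit_cube am bd smb(1)])
  then show "bounded_measurable ?M F"
    by (intro bounded_measurableI[where C = "5 / 2 * B"] Fb) auto
  fix R :: "real ^ 'n \<Rightarrow> real \<times> (real ^ 'n)" and s
  assume R: "bounded_measurable ?M R"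
    and s: "\<And>w t. l1_norm w = 1 \<Longrightarrow> 0 \<le> t \<Longrightarrow> t \<le> 1 \<Longrightarrow> \<bar>LINT x|?M. R x \<bullet> relu_atom w t x\<bar> \<le> s"
  obtain C where C: "\<And>x. x \<in> unit_cube \<Longrightarrow> norm (R x) \<le> C" and Rm: "R \<in> borel_measurable ?M"
    using R by (auto simp: bounded_measurable_def)
  have "(\<lambda>j. LINT x|?M. R x \<bullet> (a j *\<^sub>R mode_atom (\<kappa> j) x)) sums
      (LINT x|?M. (\<Sum>j. R x \<bullet> (a j *\<^sub>R mode_atom (\<kappa> j) x)))"
  proof (rule integral_bounded_series(2)[OF finite_measure_unit_cube])
    show "(\<lambda>x. R x \<bullet> (a j *\<^sub>R mode_atom (\<kappa> j) x)) \<in> borel_measurable ?M" for j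
      by (intro borel_measurable_inner Rm am)
    show "norm (R x \<bullet> (a j *\<^sub>R mode_atom (\<kappa> j) x)) \<le> C * (5 / 2 * ?b j)" if "x \<in> space ?M" for j x
    proof -
      have x: "norm (R x) \<le> C" using that C by simp
      have "norm (R x \<bullet> (a j *\<^sub>R mode_atom (\<kappa> j) x)) \<le> norm (R x) * norm (a j *\<^sub>R mode_atom (\<kappa> j) x)"
        unfolding real_norm_def by (rule Cauchy_Schwarz_ineq2)
      also have "\<dots> \<le> C * (5 / 2 * ?b j)"
        by (rule mult_mono[OF x bd order_trans[OF norm_ge_zero x] norm_ge_zero])
      finally show ?thesis .
    qed
    show "summable (\<lambda>j. C * (5 / 2 * ?b j))" by (intro summable_mult smb)
  qed
  moreover have "(\<Sum>j. R x \<bullet> (a j *\<^sub>R mode_atom (\<kappa> j) x)) = R x \<bullet> F x" for x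
    unfolding F_def by (rule bounded_linear.suminf[OF bounded_linear_inner_right sm, symmetric])
  ultimately have S: "(\<lambda>j. LINT x|?M. R x \<bullet> (a j *\<^sub>R mode_atom (\<kappa> j) x)) sums (LINT x|?M. R x \<bullet> F x)"
    by simp
  have axis: "l1_norm (axis undefined 1 :: real ^ 'n) = 1"
    by (simp add: l1_norm_def axis_def if_distrib cong: if_cong)
  have s0: "0 \<le> s"
    using s[OF axis, of 0] by (intro order_trans[OF abs_ge_zero]) auto
  have term_le: "norm (LINT x|?M. R x \<bullet> (a j *\<^sub>R mode_atom (\<kappa> j) x)) \<le> 2 * s * ?b j" for j
  proof -
    have "norm (LINT x|?M. R x \<bullet> (a j *\<^sub>R mode_atom (\<kappa> j) x)) = \<bar>a j\<bar> * \<bar>LINT x|?M. R x \<bullet> mode_atom (\<kappa> j) x\<bar>"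
      by (simp add: abs_mult)
    also have "\<dots> \<le> \<bar>a j\<bar> * (2 * (pi * freq_norm (\<kappa> j))\<^sup>2 * s)"
      by (intro mult_left_mono mode_pairing_bound R s) auto
    also have "\<dots> \<le> \<bar>a j\<bar> * (2 * (1 + (pi * freq_norm (\<kappa> j))\<^sup>2) * s)"
      using s0 by (intro mult_left_mono mult_right_mono) auto
    finally show ?thesis by (simp add: power_mult_distrib mult_ac)
  qed
  have sm2: "summable (\<lambda>j. 2 * s * ?b j)" "(\<Sum>j. 2 * s * ?b j) = 2 * s * B"
    using sums_mult[OF sums, of "2 * s"] by (simp_all add: sums_iff)
  have smI: "summable (\<lambda>j. norm (LINT x|?M. R x \<bullet> (a j *\<^sub>R mode_atom (\<kappa> j) x)))"
    by (rule summable_comparison_test'[OF sm2(1), of 0]) (use term_le in simp)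
  have "\<bar>LINT x|?M. R x \<bullet> F x\<bar> \<le> (\<Sum>j. norm (LINT x|?M. R x \<bullet> (a j *\<^sub>R mode_atom (\<kappa> j) x)))"
    using summable_norm[OF smI] sums_unique[OF S] by simp
  also have "\<dots> \<le> (\<Sum>j. 2 * s * ?b j)"
    by (rule suminf_le[OF term_le smI sm2(1)])
  finally show "\<bar>LINT x|?M. R x \<bullet> F x\<bar> \<le> 2 * B * s"
    using sm2(2) by (simp add: mult_ac)
qed

section \<open>Weak gradients\<close>

lemma bounded_measurable_continuous:
  fixes f :: "real ^ 'n \<Rightarrow> real"
  assumes "continuous_on UNIV f"
  shows "bounded_measurable (lebesgue_on unit_cube) f"
proof -
  have "bounded (f ` unit_cube)"
    using assms by (intro compact_imp_bounded compact_continuous_image) (auto intro: continuous_on_subset)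
  then obtain C where C: "\<And>x. x \<in> unit_cube \<Longrightarrow> norm (f x) \<le> C" by (auto simp: bounded_iff)
  show ?thesis
    by (rule bounded_measurableI[OF borel_measurable_integrable[OF integrable_lebesgue_on_unit_cube[OF assms]]])
       (use C in simp)
qed

lemma bounded_measurable_Pair_scaleR:
  assumes f: "bounded_measurable M f" and g: "bounded_measurable M (g :: _ \<Rightarrow> real)"
  shows "bounded_measurable M (\<lambda>x. (f x, g x *\<^sub>R c))"
proof -
  obtain C D where CD: "\<forall>x\<in>space M. norm (f x) \<le> C" "\<forall>x\<in>space M. norm (g x) \<le> D"
    using assms by (auto simp: bounded_measurable_def)
  show ?thesis
  proof (rule bounded_measurableI[where C = "C + D * norm c"])
    show "(\<lambda>x. (f x, g x *\<^sub>R c)) \<in> borel_measurable M"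
      using assms by (intro borel_measurable_Pair borel_measurable_scaleR) (auto simp: bounded_measurable_def)
    fix x assume x: "x \<in> space M"
    have "norm (f x, g x *\<^sub>R c) \<le> norm (f x) + norm (g x) * norm c"
      using norm_Pair_le[of "f x" "g x *\<^sub>R c"] by simp
    also have "\<dots> \<le> C + D * norm c"
      using CD x by (intro add_mono mult_right_mono) auto
    finally show "norm (f x, g x *\<^sub>R c) \<le> C + D * norm c" .
  qed
qed

text \<open>
  A bounded atom \<open>(v, G)\<close> has weak gradient \<open>G\<close> exactly if it is orthogonal to all these fields.
\<close>

definition test_pairing :: "(real ^ 'n \<Rightarrow> real) \<Rightarrow> 'n \<Rightarrow> real ^ 'n \<Rightarrow> real \<times> (real ^ 'n)" where
  "test_pairing \<phi> i x = (partial_deriv i \<phi> x, \<phi> x *\<^sub>R axis i 1)"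

lemma test_pairing_bounded_measurable:
  assumes "test_function \<phi>"
  shows "bounded_measurable (lebesgue_on unit_cube) (test_pairing \<phi> i)"
  unfolding test_pairing_def
  by (intro bounded_measurable_Pair_scaleR bounded_measurable_continuous
      test_function_continuous[OF assms] test_function_continuous_partial[OF assms])

lemma test_pairing_inner: "test_pairing \<phi> i x \<bullet> (v, G) = v * partial_deriv i \<phi> x + G $ i * \<phi> x"
  by (simp add: test_pairing_def inner_axis' mult.commute)

lemma bounded_measurable_bounded_linear:
  assumes f: "bounded_linear f" and E: "bounded_measurable M E"
  shows "bounded_measurable M (\<lambda>x. f (E x))"
proof -
  obtain C where C: "\<And>x. x \<in> space M \<Longrightarrow> norm (E x) \<le> C" and Em: "E \<in> borel_measurable M"
    using E by (auto simp: bounded_measurable_def)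
  obtain L where L: "0 < L" "\<And>y. norm (f y) \<le> norm y * L"
    using bounded_linear.pos_bounded[OF f] by blast
  show ?thesis
  proof (rule bounded_measurableI[where C = "C * L"])
    show "(\<lambda>x. f (E x)) \<in> borel_measurable M"
      by (rule measurable_compose[OF Em borel_measurable_continuous_onI[OF linear_continuous_on[OF f]]])
    show "norm (f (E x)) \<le> C * L" if "x \<in> space M" for x
      using L(1) by (intro order_trans[OF L(2)] mult_right_mono C that) simp
  qed
qed

lemmas bounded_measurable_fst = bounded_measurable_bounded_linear[OF bounded_linear_fst]
lemmas bounded_measurable_snd = bounded_measurable_bounded_linear[OF bounded_linear_snd]
lemmas bounded_measurable_nth = bounded_measurable_bounded_linear[OF bounded_linear_vec_nth]

lemma LINT_test_pairing:
  assumes \<phi>: "test_function \<phi>" and E: "bounded_measurable (lebesgue_on unit_cube) E"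
  shows "(LINT x|lebesgue_on unit_cube. test_pairing \<phi> i x \<bullet> E x) =
     (LINT x|lebesgue_on unit_cube. fst (E x) * partial_deriv i \<phi> x) + (LINT x|lebesgue_on unit_cube. snd (E x) $ i * \<phi> x)"
proof -
  note int = integrable_inner_bounded_measurable[OF finite_measure_unit_cube]
  have 1: "integrable (lebesgue_on unit_cube) (\<lambda>x. fst (E x) * partial_deriv i \<phi> x)"
    using int[OF bounded_measurable_fst[OF E] bounded_measurable_continuous[OF test_function_continuous_partial[OF \<phi>]]]
    by simp
  have 2: "integrable (lebesgue_on unit_cube) (\<lambda>x. snd (E x) $ i * \<phi> x)"
    using int[OF bounded_measurable_nth[OF bounded_measurable_snd[OF E]] bounded_measurable_continuous[OF test_function_continuous[OF \<phi>]]]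
    by simp
  have "test_pairing \<phi> i x \<bullet> E x = fst (E x) * partial_deriv i \<phi> x + snd (E x) $ i * \<phi> x" for x
    using test_pairing_inner[of \<phi> i x "fst (E x)" "snd (E x)"] by simp
  then show ?thesis using 1 2 by simp
qed

text \<open>
  The neuron is Lipschitz and differentiable off the hyperplane \<open>w \<bullet> x = t\<close>, which is null because
  \<open>w\<close> is not zero.
\<close>

lemma relu_atom_weak_gradient:
  assumes \<phi>: "test_function \<phi>" and w: "l1_norm w = 1" and t: "0 \<le> t"
  shows "(LINT x|lebesgue_on unit_cube. test_pairing \<phi> i x \<bullet> relu_atom w t x) = 0"
proof -
  have "(LINT x|lebesgue_on unit_cube. ReLU (w \<bullet> x - t) * partial_deriv i \<phi> x)
      = - (LINT x|lebesgue_on unit_cube. (if t < w \<bullet> x then w $ i else 0) * \<phi> x)"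
  proof (rule lipschitz_integration_by_parts[OF _ _ _ \<phi>])
    fix x y
    have "\<bar>ReLU (w \<bullet> x - t) - ReLU (w \<bullet> y - t)\<bar> \<le> \<bar>w \<bullet> (x - y)\<bar>"
      by (auto simp: ReLU_def inner_diff_right)
    also have "\<dots> \<le> norm w * norm (x - y)" by (rule Cauchy_Schwarz_ineq2)
    finally show "\<bar>ReLU (w \<bullet> x - t) - ReLU (w \<bullet> y - t)\<bar> \<le> norm w * norm (x - y)" .
  next
    show "(\<lambda>x. if t < w \<bullet> x then w $ i else 0) \<in> borel_measurable borel"
      by measurable
  next
    have "w \<noteq> 0" using w by (auto simp: l1_norm_def)
    then have "{x. w \<bullet> x = t} \<in> null_sets lebesgue"
      using negligible_hyperplane[of w t] by (simp add: negligible_iff_null_sets)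
    then have "AE x in lebesgue. x \<notin> {x. w \<bullet> x = t}" by (rule AE_not_in)
    then have ae: "AE x in lborel. x \<notin> {x. w \<bullet> x = t}"
      unfolding AE_completion_iff .
    show "AE x in lborel. ((\<lambda>h. (ReLU (w \<bullet> (x + h *\<^sub>R axis i 1) - t) - ReLU (w \<bullet> x - t)) / h)
        \<longlongrightarrow> (if t < w \<bullet> x then w $ i else 0)) (at 0)"
      using ae
    proof eventually_elim
      case (elim x)
      have "((\<lambda>h. w \<bullet> (x + h *\<^sub>R axis i 1)) \<longlongrightarrow> w \<bullet> (x + 0 *\<^sub>R axis i 1)) (at 0)"
        by (intro tendsto_intros)
      then have lim: "((\<lambda>h. w \<bullet> (x + h *\<^sub>R axis i 1)) \<longlongrightarrow> w \<bullet> x) (at 0)" by simp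
      have nz: "eventually (\<lambda>h. h \<noteq> 0) (at (0::real))"
        by (simp add: eventually_at_filter)
      show ?case
      proof (cases "t < w \<bullet> x")
        case True
        have "eventually (\<lambda>h. (ReLU (w \<bullet> (x + h *\<^sub>R axis i 1) - t) - ReLU (w \<bullet> x - t)) / h = w $ i) (at 0)"
          using order_tendstoD(1)[OF lim True] nz
        proof eventually_elim
          case (elim h)
          then show ?case using True by (simp add: ReLU_def inner_add_right inner_axis)
        qed
        then show ?thesis using True by (simp add: tendsto_eventually)
      next
        case False
        with elim have less: "w \<bullet> x < t" by simp
        have "eventually (\<lambda>h. (ReLU (w \<bullet> (x + h *\<^sub>R axis i 1) - t) - ReLU (w \<bullet> x - t)) / h = 0) (at 0)"
          using order_tendstoD(2)[OF lim less] by eventually_elim (use less in \<open>simp add: ReLU_def\<close>)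
        then show ?thesis using False by (simp add: tendsto_eventually)
      qed
    qed
  qed
  moreover have "snd (relu_atom w t x) $ i = (if t < w \<bullet> x then w $ i else 0)"
    "fst (relu_atom w t x) = ReLU (w \<bullet> x - t)" for x
    by (simp_all add: relu_atom_def)
  ultimately show ?thesis
    by (simp add: LINT_test_pairing[OF \<phi> relu_atom_bounded_measurable[OF w t]])
qed

lemma const_weak_gradient:
  assumes \<phi>: "test_function \<phi>"
  shows "(LINT x|lebesgue_on unit_cube. c * partial_deriv i \<phi> x) = 0"
  using lipschitz_integration_by_parts[OF _ _ _ \<phi>, of "\<lambda>_. c" 0 "\<lambda>_. 0" i] by simp

text \<open>
  Needed to subtract the defining identities of two weak gradients: these are integrals over the whole
  cube, although a weak gradient is only required to be integrable away from the boundary.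
\<close>

lemma locally_integrable_times_test_function:
  fixes G :: "real ^ 'n \<Rightarrow> real ^ 'n"
  assumes G: "locally_integrable G" and \<phi>: "test_function \<phi>"
  shows "integrable (lebesgue_on unit_cube) (\<lambda>x. G x $ i * \<phi> x)"
proof -
  define K where "K = closure {x. \<phi> x \<noteq> 0}"
  have K: "compact K" "K \<subseteq> interior unit_cube"
    using \<phi> by (auto simp: test_function_def K_def)
  have "integrable lebesgue (\<lambda>x. indicator K x *\<^sub>R G x)"
    using G K by (simp add: locally_integrable_def set_integrable_def)
  then have iG: "integrable lebesgue (\<lambda>x. (indicator K x *\<^sub>R G x) \<bullet> axis i 1)"
    by (rule integrable_inner_left)
  have cont: "continuous_on UNIV \<phi>" by (rule test_function_continuous[OF \<phi>])
  have "bounded (\<phi> ` unit_cube)"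
    using cont by (intro compact_imp_bounded compact_continuous_image) (auto intro: continuous_on_subset)
  then obtain C where C: "\<And>x. x \<in> unit_cube \<Longrightarrow> \<bar>\<phi> x\<bar> \<le> C" by (auto simp: bounded_iff)
  have C': "\<bar>\<phi> x\<bar> \<le> \<bar>C\<bar>" for x
    using C[of x] test_function_support[OF \<phi>, of x] by (cases "x \<in> unit_cube") (simp_all add: order_trans[OF _ abs_ge_self])
  have "integrable lebesgue (\<lambda>x. ((indicator K x *\<^sub>R G x) \<bullet> axis i 1) * \<phi> x)"
  proof (rule Bochner_Integration.integrable_bound)
    show "integrable lebesgue (\<lambda>x. C * ((indicator K x *\<^sub>R G x) \<bullet> axis i 1))"
      using iG by (rule integrable_mult_right)
    have "\<phi> \<in> borel_measurable lebesgue"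
      using borel_measurable_continuous_onI[OF cont] by (intro measurable_completion) simp
    then show "(\<lambda>x. ((indicator K x *\<^sub>R G x) \<bullet> axis i 1) * \<phi> x) \<in> borel_measurable lebesgue"
      by (rule borel_measurable_times[OF borel_measurable_integrable[OF iG]])
    show "AE x in lebesgue. norm (((indicator K x *\<^sub>R G x) \<bullet> axis i 1) * \<phi> x)
        \<le> norm (C * ((indicator K x *\<^sub>R G x) \<bullet> axis i 1))"
    proof (rule AE_I2)
      fix x
      show "norm (((indicator K x *\<^sub>R G x) \<bullet> axis i 1) * \<phi> x)
        \<le> norm (C * ((indicator K x *\<^sub>R G x) \<bullet> axis i 1))"
        using mult_right_mono[OF C'[of x] abs_ge_zero[of "(indicator K x *\<^sub>R G x) \<bullet> axis i 1"]]
        unfolding real_norm_def abs_mult by (simp only: mult.commute)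
    qed
  qed
  also have "(\<lambda>x. ((indicator K x *\<^sub>R G x) \<bullet> axis i 1) * \<phi> x) = (\<lambda>x. G x $ i * \<phi> x)"
  proof
    fix x
    have "\<phi> x = 0" if "x \<notin> K"
      using that closure_subset[of "{x. \<phi> x \<noteq> 0}"] unfolding K_def by blast
    then show "((indicator K x *\<^sub>R G x) \<bullet> axis i 1) * \<phi> x = G x $ i * \<phi> x"
      by (cases "x \<in> K") (simp_all add: inner_axis)
  qed
  finally have "integrable lebesgue (\<lambda>x. indicator unit_cube x *\<^sub>R (G x $ i * \<phi> x))"
    by (intro integrable_mult_indicator) (auto simp: unit_cube_def)
  then show ?thesis
    by (subst integrable_restrict_space) (auto simp: unit_cube_def)
qed

lemma weak_gradient_unique:
  fixes v :: "real ^ 'n \<Rightarrow> real"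
  assumes "has_weak_gradient v G" "has_weak_gradient v H"
  shows "AE x in lebesgue_on unit_cube. G x = H x"
proof -
  have li: "locally_integrable G" "locally_integrable H"
    using assms by (auto simp: has_weak_gradient_def)
  have "AE x in lebesgue_on unit_cube. G x $ i - H x $ i = 0" for i
  proof (rule test_function_orthogonal_imp_zero)
    have "(\<lambda>x. (G x - H x) \<bullet> axis i 1) absolutely_integrable_on K" if K: "compact K" "K \<subseteq> interior unit_cube" for K
    proof -
      have "set_integrable lebesgue K G" "set_integrable lebesgue K H"
        using li K by (auto simp: locally_integrable_def)
      then have "set_integrable lebesgue K (\<lambda>x. G x - H x)" by (rule set_integral_diff)
      then have "integrable lebesgue (\<lambda>x. (indicator K x *\<^sub>R (G x - H x)) \<bullet> axis i 1)"
        unfolding set_integrable_def by (rule integrable_inner_left)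
      then show ?thesis by (simp add: set_integrable_def)
    qed
    then show "locally_integrable (\<lambda>x. G x $ i - H x $ i)"
      by (simp add: locally_integrable_def inner_axis)
    fix \<phi> :: "real ^ 'n \<Rightarrow> real" assume \<phi>: "test_function \<phi>"
    have "(LINT x|lebesgue_on unit_cube. G x $ i * \<phi> x) = (LINT x|lebesgue_on unit_cube. H x $ i * \<phi> x)"
    proof -
      have "(LINT x|lebesgue_on unit_cube. v x * partial_deriv i \<phi> x) = - (LINT x|lebesgue_on unit_cube. G x $ i * \<phi> x)"
        "(LINT x|lebesgue_on unit_cube. v x * partial_deriv i \<phi> x) = - (LINT x|lebesgue_on unit_cube. H x $ i * \<phi> x)"
        using assms \<phi> unfolding has_weak_gradient_def by blast+
      then show ?thesis by simp
    qed
    then show "(LINT x|lebesgue_on unit_cube. (G x $ i - H x $ i) * \<phi> x) = 0"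
      using locally_integrable_times_test_function[OF li(1) \<phi>, of i]
        locally_integrable_times_test_function[OF li(2) \<phi>, of i]
      by (simp add: left_diff_distrib)
  qed
  then have "AE x in lebesgue_on unit_cube. \<forall>i. G x $ i - H x $ i = 0"
    by (simp add: AE_all_countable)
  then show ?thesis by eventually_elim (simp add: vec_eq_iff)
qed

text \<open>
  The defining choice of \<open>weak_gradient\<close> is arbitrary, but by uniqueness it agrees almost everywhere
  with the gradient stored in the atom.
\<close>

lemma H1_from_atom:
  fixes v :: "real ^ 'n \<Rightarrow> real"
  assumes v: "integrable (lebesgue_on unit_cube) v"
    and E: "bounded_measurable (lebesgue_on unit_cube) E"
    and ae: "AE x in lebesgue_on unit_cube. v x = c + fst (E x)"
    and weak: "\<And>\<phi> i. test_function \<phi> \<Longrightarrow> (LINT x|lebesgue_on unit_cube. test_pairing \<phi> i x \<bullet> E x) = 0"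
  shows "v \<in> H1_space"
    and "c = 0 \<Longrightarrow> H1_norm v = sqrt (LINT x|lebesgue_on unit_cube. (norm (E x))\<^sup>2)"
proof -
  let ?M = "lebesgue_on (unit_cube :: (real ^ 'n) set)"
  let ?G = "\<lambda>x. snd (E x)"
  let ?v = "\<lambda>x. c + fst (E x)"
  note int = integrable_inner_bounded_measurable[OF finite_measure_unit_cube]
  have Gb: "bounded_measurable ?M ?G" by (rule bounded_measurable_snd[OF E])
  have vb: "bounded_measurable ?M ?v"
    by (intro bounded_measurable_add bounded_measurable_const bounded_measurable_fst E)
  have vm: "v \<in> borel_measurable ?M" using v by simp
  have Gm: "?G \<in> borel_measurable ?M" using Gb by (simp add: bounded_measurable_def)
  have ae2: "AE x in ?M. (norm (?v x))\<^sup>2 = (norm (v x))\<^sup>2"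
    using ae by eventually_elim simp
  have iv: "integrable ?M (\<lambda>x. (norm (?v x))\<^sup>2)"
    using int[OF vb vb] by (simp add: power2_eq_square)
  have vL2: "v \<in> L2_space"
    unfolding L2_space_def using vm integrable_cong_AE_imp[OF iv _ ae2] by simp
  have iG: "integrable ?M (\<lambda>x. (norm (?G x))\<^sup>2)"
    using int[OF Gb Gb] by (simp add: power2_norm_eq_inner)
  have GL2: "?G \<in> L2_space"
    unfolding L2_space_def using Gm iG by simp
  have Gi: "integrable ?M ?G"
  proof -
    interpret finite_measure ?M by (rule finite_measure_unit_cube)
    show ?thesis
      using Gb unfolding bounded_measurable_def by (auto intro!: integrable_const_bound AE_I2)
  qed
  have weakG: "has_weak_gradient v ?G"
    unfolding has_weak_gradient_def
  proof (intro conjI allI impI integrable_unit_cube_locally v Gi)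
    fix \<phi> :: "real ^ 'n \<Rightarrow> real" and i assume \<phi>: "test_function \<phi>"
    let ?D = "partial_deriv i \<phi>"
    have Db: "bounded_measurable ?M ?D"
      by (intro bounded_measurable_continuous test_function_continuous_partial[OF \<phi>])
    have Dm: "?D \<in> borel_measurable ?M" using Db by (simp add: bounded_measurable_def)
    have "(LINT x|?M. v x * ?D x) = (LINT x|?M. ?v x * ?D x)"
    proof (rule integral_cong_AE)
      show "AE x in ?M. v x * ?D x = ?v x * ?D x" using ae by eventually_elim simp
      show "(\<lambda>x. v x * ?D x) \<in> borel_measurable ?M" by (intro borel_measurable_times vm Dm)
      show "(\<lambda>x. ?v x * ?D x) \<in> borel_measurable ?M"
        using vb by (intro borel_measurable_times Dm) (simp add: bounded_measurable_def)
    qed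
    also have "\<dots> = (LINT x|?M. c * ?D x) + (LINT x|?M. fst (E x) * ?D x)"
      using int[OF bounded_measurable_const Db] int[OF bounded_measurable_fst[OF E] Db]
      by (simp add: distrib_right)
    also have "\<dots> = - (LINT x|?M. ?G x $ i * \<phi> x)"
      using weak[OF \<phi>, of i, unfolded LINT_test_pairing[OF \<phi> E]] const_weak_gradient[OF \<phi>, of c i]
      by linarith
    finally show "(LINT x|?M. v x * ?D x) = - (LINT x|?M. ?G x $ i * \<phi> x)" .
  qed
  then show "v \<in> H1_space"
    using vL2 GL2 by (auto simp: H1_space_def)
  assume c: "c = 0"
  have wg: "has_weak_gradient v (weak_gradient v)"
    unfolding weak_gradient_def by (rule someI[of "has_weak_gradient v", OF weakG])
  have aeG: "AE x in ?M. ?G x = weak_gradient v x"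
    by (rule weak_gradient_unique[OF weakG wg])
  have wgl: "(LINT x|?M. (norm (weak_gradient v x))\<^sup>2) = (LINT x|?M. (norm (?G x))\<^sup>2)"
  proof -
    have "weak_gradient v \<in> borel_measurable ?M"
    proof -
      have S: "unit_cube \<inter> space lebesgue \<in> sets (lebesgue :: (real ^ 'n) measure)"
        by (simp add: unit_cube_def)
      have "(\<lambda>x. indicator unit_cube x *\<^sub>R ?G x) \<in> borel_measurable lebesgue"
        using Gm unfolding borel_measurable_restrict_space_iff[OF S] .
      moreover have "AE x in lebesgue. indicator unit_cube x *\<^sub>R ?G x = indicator unit_cube x *\<^sub>R weak_gradient v x"
        using aeG[unfolded AE_restrict_space_iff[OF S]] by eventually_elim (auto simp: indicator_def)
      ultimately show ?thesis
        unfolding borel_measurable_restrict_space_iff[OF S] by (rule borel_measurable_AE)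
    qed
    then show ?thesis
      using aeG Gm by (intro integral_cong_AE) (auto elim: eventually_mono)
  qed
  have vl: "(LINT x|?M. (norm (v x))\<^sup>2) = (LINT x|?M. (norm (?v x))\<^sup>2)"
    using ae2 vm iv by (intro integral_cong_AE) (auto elim: eventually_mono)
  have "(norm (E x))\<^sup>2 = (norm (?v x))\<^sup>2 + (norm (?G x))\<^sup>2" for x
    unfolding power2_norm_eq_inner inner_prod_def using c by simp
  then have "(LINT x|?M. (norm (E x))\<^sup>2) = (LINT x|?M. (norm (?v x))\<^sup>2) + (LINT x|?M. (norm (?G x))\<^sup>2)"
    using iv iG by simp
  also have "\<dots> = (L2_norm v)\<^sup>2 + (L2_norm (weak_gradient v))\<^sup>2"
    unfolding L2_norm_def vl wgl by simp
  finally show "H1_norm v = sqrt (LINT x|?M. (norm (E x))\<^sup>2)"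
    by (simp add: H1_norm_def)
qed

section \<open>Approximation by two-layer networks\<close>

theorem theorem2p1:
  fixes u :: "real ^ 'n \<Rightarrow> real" and m :: nat
  assumes "u \<in> barron_space" and "m \<ge> 1"
  shows "\<exists>(c :: real) (\<gamma> :: nat \<Rightarrow> real) (w :: nat \<Rightarrow> real ^ 'n) (t :: nat \<Rightarrow> real).
           \<bar>c\<bar> \<le> 2 * barron_norm u \<and>
           (\<forall>i\<in>{1..m}. l1_norm (w i) = 1 \<and> \<bar>t i\<bar> \<le> 1) \<and>
           (\<Sum>i=1..m. \<bar>\<gamma> i\<bar>) \<le> 4 * barron_norm u \<and>
           (\<lambda>x. u x - two_layer_net m c \<gamma> w t x) \<in> H1_space \<and>
           H1_norm (\<lambda>x. u x - two_layer_net m c \<gamma> w t x) \<le> sqrt 116 * barron_norm u / sqrt (real m)"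
proof -
  let ?M = "lebesgue_on (unit_cube :: (real ^ 'n) set)"
  define B where "B = barron_norm u"
  have iu: "integrable ?M u" using assms(1) by (simp add: barron_space_def)
  obtain \<kappa> :: "nat \<Rightarrow> nat ^ 'n" where \<kappa>: "bij \<kappa>"
    and sums: "(\<lambda>j. (1 + pi\<^sup>2 * (freq_norm (\<kappa> j))\<^sup>2) * \<bar>cos_coeff u (\<kappa> j)\<bar>) sums B"
    by (rule barron_enumeration[OF assms(1), folded freq_norm_def B_def])
  define a where "a j = cos_coeff u (\<kappa> j)" for j
  have sums': "(\<lambda>j. (1 + pi\<^sup>2 * (freq_norm (\<kappa> j))\<^sup>2) * \<bar>a j\<bar>) sums B"
    using sums by (simp add: a_def)
  have B0: "0 \<le> B"
    using sums_le[OF _ sums_zero sums'] by (simp add: sums_iff)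
  define F where "F x = (\<Sum>j. a j *\<^sub>R mode_atom (\<kappa> j) x)" for x
  note F_summable = barron_series_summable[OF sums']
  note F_bound = barron_series_bound[OF sums', folded F_def]
  note F_bounded_measurable = barron_series_bounded_measurable[OF sums', folded F_def]
  note F_pairing = barron_series_pairing[OF sums', folded F_def]
  have aw: "\<bar>a j\<bar> \<le> (1 + pi\<^sup>2 * (freq_norm (\<kappa> j))\<^sup>2) * \<bar>a j\<bar>" for j
    by (simp add: distrib_right)
  have sma: "summable (\<lambda>j. \<bar>a j\<bar>)"
    by (rule summable_comparison_test'[OF sums_summable[OF sums'], of 0]) (use aw in simp)
  define c where "c = (\<Sum>j. a j)"
  have cB: "\<bar>c\<bar> \<le> B"
  proof -
    have "\<bar>c\<bar> \<le> (\<Sum>j. \<bar>a j\<bar>)" unfolding c_def by (rule summable_rabs[OF sma])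
    also have "\<dots> \<le> B" using suminf_le[OF aw sma sums_summable[OF sums']] sums_unique[OF sums'] by simp
    finally show ?thesis .
  qed
  have uF: "AE x in ?M. u x = c + fst (F x)"
  proof -
    have "fst (F x) = (\<Sum>j. a j * cos_mode (\<kappa> j) x) - c" for x
    proof -
      have s1: "summable (\<lambda>j. a j * cos_mode (\<kappa> j) x)"
        by (rule summable_comparison_test'[OF sma, of 0])
           (use mult_left_mono[OF abs_cos_mode_le_1, of "\<bar>a _\<bar>"] in \<open>simp add: abs_mult\<close>)
      have "fst (F x) = (\<Sum>j. fst (a j *\<^sub>R mode_atom (\<kappa> j) x))"
        unfolding F_def by (rule bounded_linear.suminf[OF bounded_linear_fst F_summable])
      also have "\<dots> = (\<Sum>j. a j * cos_mode (\<kappa> j) x - a j)"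
        by (simp add: fst_mode_atom right_diff_distrib)
      also have "\<dots> = (\<Sum>j. a j * cos_mode (\<kappa> j) x) - c"
        unfolding c_def by (rule suminf_diff[OF s1 summable_rabs_cancel[OF sma], symmetric])
      finally show ?thesis .
    qed
    then show ?thesis
      using cosine_expansion[OF iu \<kappa> sma[unfolded a_def]] by (simp add: a_def)
  qed
  define D where "D = {(\<lambda>x :: real ^ 'n. (\<sigma> * (4 * B)) *\<^sub>R relu_atom w t x) | \<sigma> w t.
      \<sigma> \<in> {-1, 1 :: real} \<and> l1_norm w = 1 \<and> 0 \<le> t \<and> t \<le> 1}"
  have Db: "bounded_measurable ?M g" if "g \<in> D" for g
    using that by (auto simp: D_def intro!: bounded_measurable_scaleR relu_atom_bounded_measurable)
  note int = integrable_inner_bounded_measurable[OF finite_measure_unit_cube]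
  \<comment> \<open>If no neuron of weight \<open>\<plusminus> 4 B\<close> reaches the pairing \<open>q\<close> of \<open>R\<close> with \<open>F\<close>, then neurons of weight \<open>1\<close> pair to
    at most \<open>q / (4 B)\<close>, and the mass \<open>2 B\<close> of the mixture gives \<open>q \<le> q / 2\<close>.\<close>
  have step: "\<exists>g\<in>D. (LINT x|?M. R x \<bullet> F x) \<le> (LINT x|?M. R x \<bullet> g x)" if R: "bounded_measurable ?M R" for R
  proof (rule ccontr)
    assume neg: "\<not> ?thesis"
    define q where "q = (LINT x|?M. R x \<bullet> F x)"
    have lt: "4 * B * \<bar>LINT x|?M. R x \<bullet> relu_atom w t x\<bar> < q"
      if wt: "l1_norm w = 1" "0 \<le> t" "t \<le> 1" for w t
    proof -
      have "\<sigma> * (4 * B) * (LINT x|?M. R x \<bullet> relu_atom w t x) < q" if "\<sigma> \<in> {-1, 1}" for \<sigma>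
      proof -
        have "(\<lambda>x. (\<sigma> * (4 * B)) *\<^sub>R relu_atom w t x) \<in> D"
          using that wt by (auto simp: D_def)
        then have "(LINT x|?M. R x \<bullet> ((\<sigma> * (4 * B)) *\<^sub>R relu_atom w t x)) < q"
          using neg by (auto simp: q_def not_le)
        then show ?thesis by simp
      qed
      from this[of 1] this[of "-1"] show ?thesis by (simp add: abs_if)
    qed
    have axis: "l1_norm (axis undefined 1 :: real ^ 'n) = 1"
      by (simp add: l1_norm_def axis_def if_distrib cong: if_cong)
    have "0 \<le> 4 * B * \<bar>LINT x|?M. R x \<bullet> relu_atom (axis undefined 1) 0 x\<bar>"
      using B0 by simp
    then have q0: "0 < q"
      using lt[OF axis, of 0] by simp
    show False
    proof (cases "B = 0")
      case True
      have "F x = 0" for x using F_bound[of x] True by simp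
      then show False using q0 by (simp add: q_def)
    next
      case False
      with B0 have Bpos: "0 < B" by simp
      have "\<bar>q\<bar> \<le> 2 * B * (q / (4 * B))"
        unfolding q_def
      proof (rule F_pairing[OF R], fold q_def)
        fix w :: "real ^ 'n" and t :: real assume "l1_norm w = 1" "0 \<le> t" "t \<le> 1"
        from lt[OF this] Bpos show "\<bar>LINT x|?M. R x \<bullet> relu_atom w t x\<bar> \<le> q / (4 * B)"
          by (simp add: field_simps)
      qed
      also have "\<dots> = q / 2" using Bpos by simp
      finally show False using q0 by simp
    qed
  qed
  have mM: "measure ?M (space ?M) = 1"
  proof -
    have "cbox 0 (1 :: real ^ 'n) \<noteq> {}" by (simp add: interval_ne_empty_cart)
    then show ?thesis
      by (simp add: measure_restrict_space unit_cube_def content_cbox_cart)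
  qed
  \<comment> \<open>\<open>|F| \<le> 5/2 B\<close> and \<open>|g| \<le> 4 B \<cdot> 2\<close>, so the square is at most \<open>(21/2)\<^sup>2 B\<^sup>2 = 110.25 B\<^sup>2\<close>.\<close>
  have K: "(LINT x|?M. (norm (F x - g x))\<^sup>2) \<le> 116 * B\<^sup>2" if g: "g \<in> D" for g
  proof -
    have bd: "(norm (F x - g x))\<^sup>2 \<le> 116 * B\<^sup>2" if x: "x \<in> space ?M" for x
    proof -
      obtain \<sigma> w t where gd: "g = (\<lambda>x. (\<sigma> * (4 * B)) *\<^sub>R relu_atom w t x)"
        "\<sigma> \<in> {-1, 1}" "l1_norm w = 1" "0 \<le> t" using g by (auto simp: D_def)
      have "norm (g x) = 4 * B * norm (relu_atom w t x)"
        using gd B0 by (auto simp: abs_mult)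
      also have "\<dots> \<le> 4 * B * 2"
        using relu_atom_bound[OF gd(3,4)] x B0 by (intro mult_left_mono) auto
      finally have "norm (F x - g x) \<le> 5 / 2 * B + 8 * B"
        using norm_triangle_ineq4[of "F x" "g x"] F_bound[of x] by linarith
      then have "(norm (F x - g x))\<^sup>2 \<le> (21 / 2 * B)\<^sup>2"
        by (intro power_mono) auto
      also have "\<dots> = (441 / 4) * B\<^sup>2" by (simp add: power_mult_distrib power_divide)
      also have "\<dots> \<le> 116 * B\<^sup>2" by (intro mult_right_mono) auto
      finally show ?thesis .
    qed
    have Fg: "bounded_measurable ?M (\<lambda>x. F x - g x)"
      by (intro bounded_measurable_diff F_bounded_measurable Db g)
    have "(LINT x|?M. (norm (F x - g x))\<^sup>2) \<le> (LINT x|?M. 116 * B\<^sup>2)"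
      using int[OF Fg Fg] bd finite_measure.integrable_const[OF finite_measure_unit_cube]
      by (intro integral_mono) (auto simp: power2_norm_eq_inner)
    also have "\<dots> = 116 * B\<^sup>2" by (simp only: lebesgue_integral_const mM) simp
    finally show ?thesis .
  qed
  obtain g where gD: "\<And>i. i \<in> {1..m} \<Longrightarrow> g i \<in> D"
    and gle: "(LINT x|?M. (norm (real m *\<^sub>R F x - (\<Sum>i=1..m. g i x)))\<^sup>2) \<le> real m * (116 * B\<^sup>2)"
    using greedy_approximation[OF finite_measure_unit_cube F_bounded_measurable Db step K, of m] by blast
  have "\<forall>i\<in>{1..m}. \<exists>\<sigma> w t. g i = (\<lambda>x. (\<sigma> * (4 * B)) *\<^sub>R relu_atom w t x) \<and>
      \<sigma> \<in> {-1, 1 :: real} \<and> l1_norm w = 1 \<and> 0 \<le> t \<and> t \<le> 1"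
    using gD by (auto simp: D_def)
  then obtain \<sigma> w t where g: "\<And>i. i \<in> {1..m} \<Longrightarrow> g i = (\<lambda>x. (\<sigma> i * (4 * B)) *\<^sub>R relu_atom (w i) (t i) x)"
    and \<sigma>: "\<And>i. i \<in> {1..m} \<Longrightarrow> \<sigma> i \<in> {-1, 1 :: real}"
    and w: "\<And>i. i \<in> {1..m} \<Longrightarrow> l1_norm (w i) = 1"
    and t: "\<And>i. i \<in> {1..m} \<Longrightarrow> 0 \<le> t i \<and> t i \<le> 1"
    by metis
  \<comment> \<open>Dividing the unnormalised greedy sum by \<open>m\<close> makes the outer weights sum to exactly \<open>4 B\<close>.\<close>
  define \<gamma> where "\<gamma> i = \<sigma> i * (4 * B) / real m" for i
  define E where "E x = F x - (\<Sum>i=1..m. \<gamma> i *\<^sub>R relu_atom (w i) (t i) x)" for x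
  let ?v = "\<lambda>x. u x - two_layer_net m c \<gamma> w t x"
  have m0: "real m > 0" using assms(2) by simp
  have Eg: "E x = (1 / real m) *\<^sub>R (real m *\<^sub>R F x - (\<Sum>i=1..m. g i x))" for x
    using m0 by (simp add: E_def g \<gamma>_def scaleR_diff_right scaleR_sum_right)
  have atom: "bounded_measurable ?M (relu_atom (w i) (t i))" if "i \<in> {1..m}" for i
    using w t that by (intro relu_atom_bounded_measurable) auto
  have Eb: "bounded_measurable ?M E"
    unfolding E_def by (intro bounded_measurable_diff F_bounded_measurable bounded_measurable_sum bounded_measurable_scaleR atom)
  have net: "two_layer_net m c \<gamma> w t x = c + fst (\<Sum>i=1..m. \<gamma> i *\<^sub>R relu_atom (w i) (t i) x)" for x
    by (simp add: two_layer_net_def fst_sum relu_atom_def)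
  have ae: "AE x in ?M. ?v x = 0 + fst (E x)"
    using uF by eventually_elim (simp add: net E_def)
  have iv: "integrable ?M ?v"
  proof -
    have "bounded_measurable ?M (two_layer_net m c \<gamma> w t)"
      unfolding net by (intro bounded_measurable_add bounded_measurable_const bounded_measurable_fst
          bounded_measurable_sum bounded_measurable_scaleR atom)
    from int[OF this bounded_measurable_const[of ?M 1]] show ?thesis using iu by simp
  qed
  have weak: "(LINT x|?M. test_pairing \<phi> i x \<bullet> E x) = 0" if \<phi>: "test_function \<phi>" for \<phi> i
  proof -
    note tb = test_pairing_bounded_measurable[OF \<phi>, of i]
    \<comment> \<open>All neurons are orthogonal to the test field, so the pairing estimate applies with \<open>s = 0\<close>.\<close>
    have "\<bar>LINT x|?M. test_pairing \<phi> i x \<bullet> F x\<bar> \<le> 2 * B * 0"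
      by (rule F_pairing[OF tb]) (simp add: relu_atom_weak_gradient[OF \<phi>])
    moreover have "(LINT x|?M. test_pairing \<phi> i x \<bullet> E x) = (LINT x|?M. test_pairing \<phi> i x \<bullet> F x) -
        (\<Sum>j=1..m. \<gamma> j * (LINT x|?M. test_pairing \<phi> i x \<bullet> relu_atom (w j) (t j) x))"
    proof -
      have ia: "integrable ?M (\<lambda>x. \<gamma> j * (test_pairing \<phi> i x \<bullet> relu_atom (w j) (t j) x))" if "j \<in> {1..m}" for j
        using int[OF tb atom[OF that]] by (rule integrable_mult_right)
      have "(LINT x|?M. test_pairing \<phi> i x \<bullet> E x) = (LINT x|?M. test_pairing \<phi> i x \<bullet> F x -
          (\<Sum>j=1..m. \<gamma> j * (test_pairing \<phi> i x \<bullet> relu_atom (w j) (t j) x)))"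
        by (simp add: E_def inner_diff_right inner_sum_right)
      also have "\<dots> = (LINT x|?M. test_pairing \<phi> i x \<bullet> F x) -
          (LINT x|?M. (\<Sum>j=1..m. \<gamma> j * (test_pairing \<phi> i x \<bullet> relu_atom (w j) (t j) x)))"
        by (rule Bochner_Integration.integral_diff[OF int[OF tb F_bounded_measurable] Bochner_Integration.integrable_sum[OF ia]])
      also have "(LINT x|?M. (\<Sum>j=1..m. \<gamma> j * (test_pairing \<phi> i x \<bullet> relu_atom (w j) (t j) x))) =
          (\<Sum>j=1..m. LINT x|?M. \<gamma> j * (test_pairing \<phi> i x \<bullet> relu_atom (w j) (t j) x))"
        by (rule Bochner_Integration.integral_sum[OF ia])
      finally show ?thesis by simp
    qed
    ultimately show ?thesis
      using relu_atom_weak_gradient[OF \<phi>] w t by simp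
  qed
  have "H1_norm ?v = sqrt (LINT x|?M. (norm (E x))\<^sup>2)"
    by (rule H1_from_atom(2)[OF iv Eb ae weak]) auto
  also have "(LINT x|?M. (norm (E x))\<^sup>2) =
      (1 / real m)\<^sup>2 * (LINT x|?M. (norm (real m *\<^sub>R F x - (\<Sum>i=1..m. g i x)))\<^sup>2)"
    unfolding Eg norm_scaleR power_mult_distrib by simp
  also have "sqrt \<dots> \<le> sqrt ((1 / real m)\<^sup>2 * (real m * (116 * B\<^sup>2)))"
    using gle by (intro real_sqrt_le_mono mult_left_mono) auto
  also have "(1 / real m)\<^sup>2 * (real m * (116 * B\<^sup>2)) = 116 * B\<^sup>2 / real m"
    using m0 by (simp add: power2_eq_square field_simps)
  also have "sqrt \<dots> = sqrt 116 * B / sqrt (real m)"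
    using B0 by (simp add: real_sqrt_divide real_sqrt_mult)
  finally have H: "H1_norm ?v \<le> sqrt 116 * B / sqrt (real m)" .
  have "(\<Sum>i=1..m. \<bar>\<gamma> i\<bar>) = (\<Sum>i=1..m. 4 * B / real m)"
  proof (rule sum.cong[OF refl])
    fix i assume "i \<in> {1..m}"
    then have "\<bar>\<sigma> i\<bar> = 1" using \<sigma>[of i] by auto
    then show "\<bar>\<gamma> i\<bar> = 4 * B / real m" using B0 by (simp add: \<gamma>_def abs_mult)
  qed
  also have "\<dots> = 4 * B" using m0 by simp
  finally have \<gamma>sum: "(\<Sum>i=1..m. \<bar>\<gamma> i\<bar>) \<le> 4 * B" by simp
  have "?v \<in> H1_space"
    by (rule H1_from_atom(1)[OF iv Eb ae weak])
  moreover have "\<forall>i\<in>{1..m}. l1_norm (w i) = 1 \<and> \<bar>t i\<bar> \<le> 1"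
    using w t by auto
  ultimately show ?thesis
    using cB B0 \<gamma>sum H unfolding B_def by (intro exI[of _ c] exI[of _ \<gamma>] exI[of _ w] exI[of _ t]) auto
qed

end
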